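(* Let $G=(V,E)$ be an infinite, locally finite, simple, undirected, connected graph with bounded degree, $\sup_{x\in V}\deg(x)<+\infty$, let $\mathcal W=\{W_i\}_{i=1}^\infty$ be an exhaustion of $G$, and let $k,l$ be positive integers. Then $$\lambda_k^l(G)=\lim_{i\to+\infty}\lambda_k^l(W_i).$$ In particular, for $k=1$, $$\big(\lambda_1^1(G)\big)^l=\lambda_1^l(G)=\lim_{i\to+\infty}\lambda_1^l(W_i).$$
   Context: $\deg(x)$ is the number of neighbors of $x$. The graph Laplacian of $f:V\to\mathbb{C}$ is $\Delta f(x)=\sum_{y\sim x}(f(y)-f(x))$, and $\Delta^l$ is its $l$-fold iterate. $C_0(V)$ is the space of finitely supported functions $V\to\mathbb{C}$; $\langle f,g\rangle_G=\sum_{x\in V}f(x)\overline{g(x)}$ and $\|f\|_2=\langle f,f\rangle_G^{1/2}$. The $k$-th eigenvalue of the poly-Laplace on the infinite graph $G$ is defined as $$\lambda_k^l(G)=\inf_{\substack{M\subseteq C_0(V)\\ \dim M=k}}\ \max_{\substack{f\in M\\ \|f\|_2=1}}\langle(-\Delta)^lf,f\rangle_G,$$ where $M$ ranges over $k$-dimensional linear subspaces. For a finite vertex subset $W\subset V$ and $f:W\to\mathbb{C}$, let $f^*$ be its extension by zero to $V$, and let $\Delta_W^{l,\mathcal D}f=(\Delta^lf^* )|_W$ be the Dirichlet poly-Laplace operator. $\lambda_1^l(W)\leqslant\dots\leqslant\lambda_{|W|}^l(W)$ are the (real) eigenvalues of the self-adjoint operator $(-1)^l\Delta_W^{l,\mathcal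 D}$ on $\mathbb{C}^W$, with multiplicity, in nondecreasing order; $\lambda_k^l(W)$ is defined when $k\leqslant|W|$, so $\lambda_k^l(W_i)$ is defined for all sufficiently large $i$. The superscript in $\lambda_k^l$ is an index (order of the operator), whereas $(\lambda_1^1(G))^l$ is the $l$-th power of $\lambda_1^1(G)$. An exhaustion of $G$ is a sequence of subsets of vertices $\{W_i\}_{i\geqslant1}$ with $W_1\subseteq W_2\subseteq\dots\subseteq V$, $|W_i|<\infty$ for all $i$, and $V=\bigcup_{i=1}^\infty W_i$. *)

theory Defs
  imports "HOL-Analysis.Analysis" "HOL-Library.Function_Algebras" "HOL-Library.Multiset"
begin

section \<open>Graphs\<close>

text \<open>The edge set is given as a symmetric irreflexive relation: an undirected edge
  between \<open>x\<close> and \<open>y\<close> is represented by the two pairs \<open>(x, y)\<close> and \<open>(y, x)\<close>.\<close>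

definition simple_graph :: "'a set \<Rightarrow> 'a rel \<Rightarrow> bool" where
  "simple_graph V E \<longleftrightarrow> E \<subseteq> V \<times> V \<and> sym E \<and> irrefl E"

definition neighbors :: "'a rel \<Rightarrow> 'a \<Rightarrow> 'a set" where
  "neighbors E x = {y. (x, y) \<in> E}"

definition deg :: "'a rel \<Rightarrow> 'a \<Rightarrow> nat" where
  "deg E x = card (neighbors E x)"

definition locally_finite :: "'a set \<Rightarrow> 'a rel \<Rightarrow> bool" where
  "locally_finite V E \<longleftrightarrow> (\<forall>x\<in>V. finite (neighbors E x))"

definition connected_graph :: "'a set \<Rightarrow> 'a rel \<Rightarrow> bool" where
  "connected_graph V E \<longleftrightarrow> (\<forall>x\<in>V. \<forall>y\<in>V. (x, y) \<in> E\<^sup>*)"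

text \<open>The sequence is indexed from 1; the value \<open>W 0\<close> plays no role.\<close>

definition exhaustion :: "'a set \<Rightarrow> (nat \<Rightarrow> 'a set) \<Rightarrow> bool" where
  "exhaustion V W \<longleftrightarrow>
     (\<forall>i\<ge>1. W i \<subseteq> W (Suc i)) \<and> (\<forall>i\<ge>1. finite (W i)) \<and> V = (\<Union>i\<in>{1..}. W i)"

section \<open>Functions on the vertices\<close>

text \<open>Functions on a set \<open>S\<close> of vertices are represented by functions on the whole type that
  vanish outside \<open>S\<close>. In particular \<open>\<complex>\<^sup>W\<close> is identified with its image under extension by zero.\<close>

definition cscale :: "complex \<Rightarrow> ('a \<Rightarrow> complex) \<Rightarrow> ('a \<Rightarrow> complex)" where
  "cscale c f = (\<lambda>x. c * f x)"

interpretation cfun: vector_space "cscale :: complex \<Rightarrow> ('a \<Rightarrow> complex) \<Rightarrow> ('a \<Rightarrow> complex)"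
  by unfold_locales (simp_all add: cscale_def fun_eq_iff algebra_simps)

definition functions_on :: "'a set \<Rightarrow> ('a \<Rightarrow> complex) set" where
  "functions_on S = {f. \<forall>x. x \<notin> S \<longrightarrow> f x = 0}"

definition C0 :: "'a set \<Rightarrow> ('a \<Rightarrow> complex) set" where
  "C0 V = {f \<in> functions_on V. finite {x. f x \<noteq> 0}}"

text \<open>Only used for finitely supported functions, where the infinite sum is a finite one.\<close>

definition inner_G :: "'a set \<Rightarrow> ('a \<Rightarrow> complex) \<Rightarrow> ('a \<Rightarrow> complex) \<Rightarrow> complex" where
  "inner_G V f g = (\<Sum>\<^sub>\<infinity>x\<in>V. f x * cnj (g x))"

definition norm2 :: "'a set \<Rightarrow> ('a \<Rightarrow> complex) \<Rightarrow> real" where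
  "norm2 V f = sqrt (Re (inner_G V f f))"

definition laplacian :: "'a rel \<Rightarrow> ('a \<Rightarrow> complex) \<Rightarrow> ('a \<Rightarrow> complex)" where
  "laplacian E f = (\<lambda>x. \<Sum>y\<in>neighbors E x. f y - f x)"

section \<open>Eigenvalues on the infinite graph\<close>

text \<open>The form \<open>\<langle>(-\<Delta>)\<^sup>l f, f\<rangle>\<close> is real by symmetry of \<open>\<Delta>\<close>; \<open>Re\<close> only changes its type.\<close>

definition poly_form :: "'a set \<Rightarrow> 'a rel \<Rightarrow> nat \<Rightarrow> ('a \<Rightarrow> complex) \<Rightarrow> real" where
  "poly_form V E l f = Re (inner_G V (((\<lambda>g. - laplacian E g) ^^ l) f) f)"

text \<open>\<open>GREATEST\<close> is the maximum; it exists because the unit sphere of \<open>M\<close> is compact and, for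
  \<open>k \<ge> 1\<close>, nonempty. For \<open>k \<ge> 1\<close> the condition \<open>cfun.dim M = k\<close> also excludes
  infinite-dimensional \<open>M\<close>, whose \<open>dim\<close> is 0 by convention.\<close>

definition lambda_G :: "'a set \<Rightarrow> 'a rel \<Rightarrow> nat \<Rightarrow> nat \<Rightarrow> real" where
  "lambda_G V E l k =
     (INF M \<in> {M. cfun.subspace M \<and> M \<subseteq> C0 V \<and> cfun.dim M = k}.
        (GREATEST r. r \<in> poly_form V E l ` {f \<in> M. norm2 V f = 1}))"

section \<open>Dirichlet eigenvalues on finite subsets\<close>

definition restrict_zero :: "'a set \<Rightarrow> ('a \<Rightarrow> complex) \<Rightarrow> ('a \<Rightarrow> complex)" where
  "restrict_zero W f = (\<lambda>x. if x \<in> W then f x else 0)"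

text \<open>By the identification of \<open>\<complex>\<^sup>W\<close> above, \<open>restrict_zero W\<close> serves both as the extension
  \<open>f \<mapsto> f\<^sup>*\<close> and as the restriction to \<open>W\<close>.\<close>

definition dirichlet_op :: "'a rel \<Rightarrow> nat \<Rightarrow> 'a set \<Rightarrow> ('a \<Rightarrow> complex) \<Rightarrow> ('a \<Rightarrow> complex)" where
  "dirichlet_op E l W f = restrict_zero W ((laplacian E ^^ l) (restrict_zero W f))"

definition dirichlet_eigenspace :: "'a rel \<Rightarrow> nat \<Rightarrow> 'a set \<Rightarrow> real \<Rightarrow> ('a \<Rightarrow> complex) set" where
  "dirichlet_eigenspace E l W \<mu> =
     {f \<in> functions_on W. cscale ((- 1) ^ l) (dirichlet_op E l W f) = cscale (of_real \<mu>) f}"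

text \<open>The operator is self-adjoint on \<open>\<complex>\<^sup>W\<close>, so all its eigenvalues are real and the
  multiplicity of an eigenvalue is the dimension of its eigenspace.\<close>

definition dirichlet_eigenvalues :: "'a rel \<Rightarrow> nat \<Rightarrow> 'a set \<Rightarrow> real multiset" where
  "dirichlet_eigenvalues E l W =
     (\<Sum>\<mu> \<in> {\<mu>. \<exists>f \<in> dirichlet_eigenspace E l W \<mu>. f \<noteq> 0}.
        replicate_mset (cfun.dim (dirichlet_eigenspace E l W \<mu>)) \<mu>)"

text \<open>The list is nondecreasing and, for finite \<open>W\<close>, has length \<open>card W\<close>; its positions are
  counted from 0. The value is meaningful for \<open>1 \<le> k \<le> card W\<close>.\<close>

definition lambda_W :: "'a rel \<Rightarrow> nat \<Rightarrow> nat \<Rightarrow> 'a set \<Rightarrow> real" where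
  "lambda_W E l k W = sorted_list_of_multiset (dirichlet_eigenvalues E l W) ! (k - 1)"

end

theory Submission
  imports Defs
begin

text \<open>Write \<open>A = - \<Delta>\<close>, a symmetric and nonnegative operator on finitely supported functions which
preserves finiteness of the support, and write \<open>m\<^sub>l(f) = \<langle>A\<^sup>l f, f\<rangle>\<close>, which is \<open>poly_form V E l f\<close>.

\<^bold>\<open>Convergence.\<close> For functions \<open>f\<close> supported in a finite set \<open>W\<close>, the quadratic form of the Dirichlet operator
of order \<open>l\<close> on \<open>W\<close> is again \<open>m\<^sub>l(f)\<close>, since restricting \<open>A\<^sup>l f\<close> to \<open>W\<close> does not change its inner
product with \<open>f\<close>. By the Courant-Fischer principle (\<open>Courant_Fischer\<close>, \<open>lambda_W_minmax\<close>),
\<open>\<lambda>\<^sub>k\<^sup>l(W)\<close> is therefore the minimum of the same expression whose infimum is \<open>\<lambda>\<^sub>k\<^sup>l(G)\<close>, with the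
\<open>k\<close>-dimensional spaces \<open>M\<close> restricted to those supported in \<open>W\<close>. Hence \<open>\<lambda>\<^sub>k\<^sup>l(W) \<ge> \<lambda>\<^sub>k\<^sup>l(G)\<close>. Conversely,
a finite-dimensional \<open>M\<close> that is almost optimal for \<open>G\<close> consists of functions with a common finite
support, so it competes for \<open>\<lambda>\<^sub>k\<^sup>l(W\<^sub>i)\<close> as soon as \<open>W\<^sub>i\<close> contains that support. This is
\<open>lambda_W_tendsto_lambda_G\<close>.

The Courant-Fischer principle rests on an orthonormal eigenbasis (\<open>spectral_theorem\<close>). A maximal
orthonormal set of eigenvectors spans, because its orthogonal complement is invariant and, if
nonzero, contains an eigenvector: a maximizer of the quadratic form on the unit sphere, which is
compact. The same compactness shows that the maxima in the definition of \<open>\<lambda>\<^sub>k\<^sup>l(G)\<close> are attained.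

\<^bold>\<open>Powers.\<close> Let \<open>L = \<lambda>\<^sub>1\<^sup>1(G)\<close>, the infimum of \<open>m\<^sub>1\<close> over unit vectors. From \<open>A \<ge> L \<ge> 0\<close> one gets
\<open>m\<^sub>l\<^sub>+\<^sub>1(f) \<ge> L m\<^sub>l(f)\<close> (\<open>poly_form_Suc_ge\<close>), so \<open>m\<^sub>l \<ge> L\<^sup>l\<close> on unit vectors. For the reverse inequality,
choose unit vectors \<open>f\<^sub>n\<close> with \<open>m\<^sub>1(f\<^sub>n) \<longrightarrow> L\<close>. The operator \<open>B = A - L\<close> is nonnegative, and bounded because
the degrees are, so that \<open>\<parallel>B f\<^sub>n\<parallel>\<^sup>2 \<le> D \<langle>B f\<^sub>n, f\<^sub>n\<rangle> \<longrightarrow> 0\<close> (\<open>norm_bound_of_form_bound\<close>): the \<open>f\<^sub>n\<close> are approximate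
eigenvectors. Then \<open>m\<^sub>l\<^sub>+\<^sub>1(f\<^sub>n) - L m\<^sub>l(f\<^sub>n) = \<langle>B f\<^sub>n, A\<^sup>l f\<^sub>n\<rangle> \<longrightarrow> 0\<close>, and induction gives \<open>m\<^sub>l(f\<^sub>n) \<longrightarrow> L\<^sup>l\<close>. This is
\<open>lambda_G_1_power\<close>.\<close>

section \<open>Finitely supported functions and their inner product\<close>

interpretation cpair: vector_space_pair
  "cscale :: complex \<Rightarrow> ('a \<Rightarrow> complex) \<Rightarrow> ('a \<Rightarrow> complex)"
  "cscale :: complex \<Rightarrow> ('b \<Rightarrow> complex) \<Rightarrow> ('b \<Rightarrow> complex)"
  ..

abbreviation clinear :: "(('a \<Rightarrow> complex) \<Rightarrow> ('a \<Rightarrow> complex)) \<Rightarrow> bool" where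
  "clinear T \<equiv> Vector_Spaces.linear cscale cscale T"

lemma clinearI:
  assumes "\<And>f g. T (f + g) = T f + T g" and "\<And>c f. T (cscale c f) = cscale c (T f)"
  shows "clinear T"
  using assms by (simp add: Vector_Spaces.linear_iff cfun.vector_space_axioms)

lemma cscale_apply [simp]: "cscale c f x = c * f x"
  by (simp add: cscale_def)

lemma sum_fun_apply: "(\<Sum>s\<in>S. F s) x = (\<Sum>s\<in>S. F s x)" for F :: "'b \<Rightarrow> 'a \<Rightarrow> complex"
proof (induction S rule: infinite_finite_induct)
  case (insert y S)
  then show ?case by (simp only: sum.insert plus_fun_apply simp_thms)
qed auto

lemma functions_on_subspace: "cfun.subspace (functions_on S)"
  by (auto simp: cfun.subspace_def functions_on_def)

lemma C0_subspace: "cfun.subspace (C0 V)"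
proof -
  have "finite {x. f x + g x \<noteq> 0}"
    if "finite {x. f x \<noteq> 0}" "finite {x. g x \<noteq> 0}" for f g :: "'a \<Rightarrow> complex"
    by (rule finite_subset[of _ "{x. f x \<noteq> 0} \<union> {x. g x \<noteq> 0}"]) (use that in auto)
  moreover have "finite {x. c * f x \<noteq> 0}"
    if "finite {x. f x \<noteq> 0}" for c and f :: "'a \<Rightarrow> complex"
    by (rule finite_subset[OF _ that]) auto
  ultimately show ?thesis
    by (auto simp: cfun.subspace_def C0_def functions_on_def)
qed

lemma functions_on_subset_C0:
  assumes "finite S" "S \<subseteq> V" shows "functions_on S \<subseteq> C0 V"
proof
  fix f :: "'a \<Rightarrow> complex" assume f: "f \<in> functions_on S"
  have "finite {x. f x \<noteq> 0}"
    by (rule finite_subset[OF _ assms(1)]) (use f in \<open>auto simp: functions_on_def\<close>)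
  then show "f \<in> C0 V" using f assms(2) by (auto simp: C0_def functions_on_def)
qed

lemma C0_support:
  assumes "f \<in> C0 V" obtains S where "finite S" "S \<subseteq> V" "f \<in> functions_on S"
proof
  show "finite {x. f x \<noteq> 0}" "{x. f x \<noteq> 0} \<subseteq> V" "f \<in> functions_on {x. f x \<noteq> 0}"
    using assms by (auto simp: C0_def functions_on_def)
qed

lemma C0_common_support:
  assumes "f \<in> C0 V" "g \<in> C0 V"
  obtains S where "finite S" "S \<subseteq> V" "f \<in> functions_on S" "g \<in> functions_on S"
proof -
  obtain A B where "finite A" "A \<subseteq> V" "f \<in> functions_on A" "finite B" "B \<subseteq> V" "g \<in> functions_on B"
    using assms C0_support by metis
  then show ?thesis using that[of "A \<union> B"] by (auto simp: functions_on_def)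
qed

text \<open>Only the first argument has to be supported in \<open>S\<close>; this is what allows one to pair a function on \<open>S\<close>
with its image under an operator that enlarges the support.\<close>

lemma inner_G_eq_sum:
  assumes "finite S" "S \<subseteq> V" "f \<in> functions_on S"
  shows "inner_G V f g = (\<Sum>x\<in>S. f x * cnj (g x))"
proof -
  have "inner_G V f g = (\<Sum>\<^sub>\<infinity>x\<in>S. f x * cnj (g x))"
    unfolding inner_G_def
    by (rule infsum_cong_neutral) (use assms in \<open>auto simp: functions_on_def\<close>)
  then show ?thesis using assms(1) by simp
qed

lemma inner_G_commute: "inner_G V g f = cnj (inner_G V f g)"
  unfolding inner_G_def by (subst infsum_cnj[symmetric]) (simp add: mult.commute)

lemma inner_G_add_left:
  assumes "f \<in> C0 V" "g \<in> C0 V"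
  shows "inner_G V (f + g) h = inner_G V f h + inner_G V g h"
proof -
  obtain S where S: "finite S" "S \<subseteq> V" "f \<in> functions_on S" "g \<in> functions_on S"
    using C0_common_support assms by metis
  then have "f + g \<in> functions_on S" by (auto simp: functions_on_def)
  with S show ?thesis by (simp add: inner_G_eq_sum[of S] sum.distrib algebra_simps)
qed

lemma inner_G_scale_left:
  assumes "f \<in> C0 V"
  shows "inner_G V (cscale c f) h = c * inner_G V f h"
proof -
  obtain S where S: "finite S" "S \<subseteq> V" "f \<in> functions_on S"
    using C0_support assms by metis
  then have "cscale c f \<in> functions_on S" by (auto simp: functions_on_def)
  with S show ?thesis by (simp add: inner_G_eq_sum[of S] sum_distrib_left algebra_simps)
qed

lemma inner_G_scale_right:
  assumes "f \<in> C0 V"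
  shows "inner_G V h (cscale c f) = cnj c * inner_G V h f"
  by (metis inner_G_scale_left[OF assms] inner_G_commute complex_cnj_mult)

lemma inner_G_zero_left [simp]: "inner_G V 0 h = 0"
  by (simp add: inner_G_def)

lemma inner_G_diff_left:
  assumes "f \<in> C0 V" "g \<in> C0 V"
  shows "inner_G V (f - g) h = inner_G V f h - inner_G V g h"
proof -
  have "f - g \<in> C0 V" using assms C0_subspace cfun.subspace_diff by blast
  from inner_G_add_left[OF this assms(2), of h] show ?thesis by simp
qed

lemma inner_G_sum_left:
  assumes "\<And>s. s \<in> S \<Longrightarrow> F s \<in> C0 V"
  shows "inner_G V (\<Sum>s\<in>S. F s) h = (\<Sum>s\<in>S. inner_G V (F s) h)"
  using assms
proof (induction S rule: infinite_finite_induct)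
  case (insert x S)
  then have "(\<Sum>s\<in>S. F s) \<in> C0 V" by (intro cfun.subspace_sum[OF C0_subspace]) auto
  then have "inner_G V (F x + (\<Sum>s\<in>S. F s)) h = inner_G V (F x) h + inner_G V (\<Sum>s\<in>S. F s) h"
    using insert by (intro inner_G_add_left) auto
  then show ?case using insert by (simp only: sum.insert insert_iff simp_thms)
qed auto

lemma inner_G_self_sum:
  assumes "finite S" "S \<subseteq> V" "f \<in> functions_on S"
  shows "inner_G V f f = of_real (\<Sum>x\<in>S. (cmod (f x))\<^sup>2)"
  by (simp add: inner_G_eq_sum[OF assms] complex_norm_square[symmetric] flip: of_real_power)

lemma inner_G_self_nonneg: "f \<in> C0 V \<Longrightarrow> 0 \<le> Re (inner_G V f f)"
  by (metis C0_support inner_G_self_sum Re_complex_of_real sum_nonneg zero_le_power2)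

lemma inner_G_self_real: "Im (inner_G V f f) = 0"
  using inner_G_commute[of V f f] by (simp add: complex_eq_iff)

lemma inner_G_self_eq_0:
  assumes "f \<in> C0 V" "Re (inner_G V f f) = 0" shows "f = 0"
proof -
  obtain S where S: "finite S" "S \<subseteq> V" "f \<in> functions_on S"
    using C0_support assms by metis
  then have "(\<Sum>x\<in>S. (cmod (f x))\<^sup>2) = 0" using assms(2) inner_G_self_sum[OF S] by simp
  then have "\<forall>x\<in>S. f x = 0" using S(1) by (simp add: sum_nonneg_eq_0_iff)
  then show ?thesis using S by (auto simp: functions_on_def fun_eq_iff)
qed

lemma norm2_eq_1_iff: "norm2 V f = 1 \<longleftrightarrow> Re (inner_G V f f) = 1"
  by (simp add: norm2_def)

section \<open>The Cauchy-Schwarz inequality for nonnegative forms\<close>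

definition symmetric_on :: "'a set \<Rightarrow> ('a \<Rightarrow> complex) set \<Rightarrow> (('a \<Rightarrow> complex) \<Rightarrow> ('a \<Rightarrow> complex)) \<Rightarrow> bool" where
  "symmetric_on V X T \<longleftrightarrow> (\<forall>f\<in>X. \<forall>g\<in>X. inner_G V (T f) g = inner_G V f (T g))"

text \<open>The usual argument, for a form that may be degenerate: expand \<open>q(f - t b g, f - t b g) \<ge> 0\<close> with \<open>b = q(f, g)\<close>
and choose the real number \<open>t\<close>. The semidefinite case is essential below, where the form vanishes at a
maximizer or is nearly degenerate at the bottom of the spectrum.\<close>

lemma Cauchy_Schwarz_form:
  assumes X: "cfun.subspace X"
    and add: "\<And>f g h. f \<in> X \<Longrightarrow> g \<in> X \<Longrightarrow> h \<in> X \<Longrightarrow> q (f + g) h = q f h + q g h"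
    and scale: "\<And>c f g. f \<in> X \<Longrightarrow> g \<in> X \<Longrightarrow> q (cscale c f) g = c * q f g"
    and herm: "\<And>f g. f \<in> X \<Longrightarrow> g \<in> X \<Longrightarrow> q g f = cnj (q f g)"
    and pos: "\<And>f. f \<in> X \<Longrightarrow> 0 \<le> Re (q f f)"
    and f: "f \<in> X" and g: "g \<in> X"
  shows "(cmod (q f g))\<^sup>2 \<le> Re (q f f) * Re (q g g)"
proof -
  define b where "b = q f g"
  define c where "c = Re (q g g)"
  have exp: "0 \<le> Re (q f f) - 2 * t * (cmod b)\<^sup>2 + t\<^sup>2 * (cmod b)\<^sup>2 * c" for t :: real
  proof -
    define s where "s = - (of_real t * b)"
    have sg: "cscale s g \<in> X" "f + cscale s g \<in> X"
      using X f g by (auto intro: cfun.subspace_add cfun.subspace_scale)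
    have "q (f + cscale s g) (f + cscale s g) = q f (f + cscale s g) + s * q g (f + cscale s g)"
      using f g sg by (simp add: add scale)
    also have "q f (f + cscale s g) = cnj (q f f + s * q g f)"
      using f g sg herm[of "f + cscale s g" f] by (simp add: add scale)
    also have "q g (f + cscale s g) = cnj (q f g + s * q g g)"
      using f g sg herm[of "f + cscale s g" g] by (simp add: add scale)
    also have "q g f = cnj b" using herm[OF f g] by (simp add: b_def)
    also have "q g g = of_real c"
      using herm[OF g g] by (simp add: c_def complex_eq_iff)
    finally have eq: "q (f + cscale s g) (f + cscale s g)
        = cnj (q f f + s * cnj b) + s * cnj (b + s * of_real c)" unfolding b_def .
    have "0 \<le> Re (cnj (q f f + s * cnj b) + s * cnj (b + s * of_real c))"
      using pos[OF sg(2)] by (simp add: eq)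
    also have "\<dots> = Re (q f f) - 2 * t * (cmod b)\<^sup>2 + t\<^sup>2 * (cmod b)\<^sup>2 * c"
      unfolding cmod_power2 s_def by (simp add: power2_eq_square algebra_simps)
    finally show ?thesis .
  qed
  have c0: "0 \<le> c" using pos[OF g] by (simp add: c_def)
  have "(cmod b)\<^sup>2 \<le> Re (q f f) * c"
  proof (cases "c = 0")
    case True
    \<comment> \<open>With \<open>c = 0\<close> the bound is affine in \<open>t\<close>, and this \<open>t\<close> brings its value down to \<open>-1\<close>.\<close>
    have "(cmod b)\<^sup>2 \<le> 0"
    proof (rule ccontr)
      assume "\<not> (cmod b)\<^sup>2 \<le> 0"
      then have "0 < (cmod b)\<^sup>2" by simp
      then show False
        using exp[of "(Re (q f f) + 1) / (2 * (cmod b)\<^sup>2)"] True by (simp add: field_simps)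
    qed
    then show ?thesis using True by simp
  next
    case False
    then have "0 < c" using c0 by simp
    \<comment> \<open>The minimizer of the quadratic polynomial in \<open>t\<close> is \<open>1 / c\<close>.\<close>
    then show ?thesis
      using exp[of "1 / c"] by (simp add: field_simps power2_eq_square)
  qed
  then show ?thesis by (simp add: b_def c_def)
qed

lemma Cauchy_Schwarz_operator:
  assumes X: "cfun.subspace X" "X \<subseteq> C0 V" and T: "clinear T" "T ` X \<subseteq> C0 V" "symmetric_on V X T"
    and pos: "\<And>f. f \<in> X \<Longrightarrow> 0 \<le> Re (inner_G V (T f) f)"
    and fg: "f \<in> X" "g \<in> X"
  shows "(cmod (inner_G V (T f) g))\<^sup>2 \<le> Re (inner_G V (T f) f) * Re (inner_G V (T g) g)"
proof (rule Cauchy_Schwarz_form[OF X(1), where q = "\<lambda>f g. inner_G V (T f) g"])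
  fix f g assume fg: "f \<in> X" "g \<in> X"
  show "inner_G V (T g) f = cnj (inner_G V (T f) g)"
    using T(3) fg by (metis symmetric_on_def inner_G_commute)
next
  fix f g h assume "f \<in> X" "g \<in> X" "h \<in> X"
  then show "inner_G V (T (f + g)) h = inner_G V (T f) h + inner_G V (T g) h"
    using T by (subst cpair.linear_add[OF T(1)], subst inner_G_add_left) auto
next
  fix c f g assume "f \<in> X" "g \<in> X"
  then show "inner_G V (T (cscale c f)) g = c * inner_G V (T f) g"
    using T by (subst cpair.linear_scale[OF T(1)], subst inner_G_scale_left) auto
qed (use assms in auto)


lemma Cauchy_Schwarz_inner_G:
  assumes "f \<in> C0 V" "g \<in> C0 V"
  shows "(cmod (inner_G V f g))\<^sup>2 \<le> Re (inner_G V f f) * Re (inner_G V g g)"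
proof (rule Cauchy_Schwarz_operator[OF C0_subspace order_refl, of "\<lambda>h. h"])
  show "clinear (\<lambda>h :: 'a \<Rightarrow> complex. h)" by (intro clinearI) simp_all
qed (use assms inner_G_self_nonneg in \<open>auto simp: symmetric_on_def\<close>)

text \<open>For a nonnegative operator with \<open>T \<le> C\<close> one has \<open>T\<^sup>2 \<le> C T\<close>. It follows from the Cauchy-Schwarz inequality
for the form of \<open>T\<close>, applied to \<open>f\<close> and \<open>T f\<close>, and so it needs no spectral theory in infinite dimensions.\<close>

lemma norm_bound_of_form_bound:
  assumes X: "cfun.subspace X" "X \<subseteq> C0 V" and T: "clinear T" "T ` X \<subseteq> X" "symmetric_on V X T"
    and pos: "\<And>f. f \<in> X \<Longrightarrow> 0 \<le> Re (inner_G V (T f) f)"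
    and upper: "\<And>f. f \<in> X \<Longrightarrow> Re (inner_G V (T f) f) \<le> C * Re (inner_G V f f)" and C: "0 \<le> C"
    and f: "f \<in> X"
  shows "Re (inner_G V (T f) (T f)) \<le> C * Re (inner_G V (T f) f)"
proof -
  define n where "n = Re (inner_G V (T f) (T f))"
  define a where "a = Re (inner_G V (T f) f)"
  have Tf: "T f \<in> X" using T(2) f by auto
  have n: "0 \<le> n" using inner_G_self_nonneg X(2) Tf by (auto simp: n_def)
  have a: "0 \<le> a" using pos[OF f] by (simp add: a_def)
  have "n\<^sup>2 \<le> (cmod (inner_G V (T f) (T f)))\<^sup>2"
    using abs_Re_le_cmod[of "inner_G V (T f) (T f)"] n by (intro power_mono) (auto simp: n_def)
  also have "\<dots> \<le> a * Re (inner_G V (T (T f)) (T f))"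
    unfolding a_def using T(2) X(2) by (intro Cauchy_Schwarz_operator[OF X T(1) _ T(3) pos f Tf]) auto
  also have "\<dots> \<le> a * (C * n)" using upper[OF Tf] a by (simp add: n_def mult_left_mono)
  finally have "n * n \<le> (C * a) * n" by (simp add: power2_eq_square mult_ac)
  then show ?thesis using n a C by (cases "n = 0") (auto simp: n_def a_def mult_le_cancel_right)
qed

section \<open>Quadratic forms and unit vectors\<close>

text \<open>The scaling factor is real, so the quadratic form of any linear operator scales by \<open>r\<^sup>2\<close>; bounds on the
unit sphere thereby extend to all vectors.\<close>

lemma unit_multiple:
  assumes X: "cfun.subspace X" "X \<subseteq> C0 V" and f: "f \<in> X" "f \<noteq> 0"
  obtains u r where "u \<in> X" "norm2 V u = 1" "f = cscale (complex_of_real r) u"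
    "r\<^sup>2 = Re (inner_G V f f)"
proof -
  define r where "r = sqrt (Re (inner_G V f f))"
  have fC: "f \<in> C0 V" using X f by auto
  have p: "0 < Re (inner_G V f f)"
    using inner_G_self_nonneg[OF fC] inner_G_self_eq_0[OF fC] f(2) by fastforce
  then have r: "r > 0" "r\<^sup>2 = Re (inner_G V f f)" by (simp_all add: r_def)
  define u where "u = cscale (complex_of_real (1 / r)) f"
  have fu: "f = cscale (complex_of_real r) u"
    using r by (simp add: u_def fun_eq_iff)
  have uX: "u \<in> X" using X(1) f(1) by (simp add: u_def cfun.subspace_scale)
  have "Re (inner_G V f f) = r\<^sup>2 * Re (inner_G V u u)"
    using uX X(2) by (subst (1 2) fu)
      (simp add: inner_G_scale_left[of u] inner_G_scale_right[of u] cfun.subspace_scale[OF C0_subspace] subset_iff power2_eq_square)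
  then have "norm2 V u = 1" using r p by (simp add: norm2_eq_1_iff)
  with uX fu r(2) show ?thesis using that by blast
qed

lemma quadratic_form_scale:
  assumes "clinear T" "f \<in> C0 V" "T f \<in> C0 V"
  shows "Re (inner_G V (T (cscale (complex_of_real r) f)) (cscale (complex_of_real r) f))
    = r\<^sup>2 * Re (inner_G V (T f) f)"
  using assms by (simp add: cpair.linear_scale[OF assms(1)] inner_G_scale_left inner_G_scale_right
      power2_eq_square)

lemma quadratic_form_upper_bound:
  assumes X: "cfun.subspace X" "X \<subseteq> C0 V" and T: "clinear T" "T ` X \<subseteq> C0 V"
    and unit: "\<And>u. u \<in> X \<Longrightarrow> norm2 V u = 1 \<Longrightarrow> Re (inner_G V (T u) u) \<le> c"
    and f: "f \<in> X"
  shows "Re (inner_G V (T f) f) \<le> c * Re (inner_G V f f)"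
proof (cases "f = 0")
  case True
  then show ?thesis using cpair.linear_0[OF T(1)] by simp
next
  case False
  obtain u r where u: "u \<in> X" "norm2 V u = 1" "f = cscale (complex_of_real r) u"
    "r\<^sup>2 = Re (inner_G V f f)" using unit_multiple[OF X f False] by metis
  have "Re (inner_G V (T f) f) = r\<^sup>2 * Re (inner_G V (T u) u)"
    unfolding u(3) by (rule quadratic_form_scale) (use u X T in auto)
  also have "\<dots> \<le> r\<^sup>2 * c" using unit[OF u(1,2)] by (simp add: mult_left_mono)
  finally show ?thesis using u(4) by (simp add: mult.commute)
qed

lemma quadratic_form_lower_bound:
  assumes X: "cfun.subspace X" "X \<subseteq> C0 V" and T: "clinear T" "T ` X \<subseteq> C0 V"
    and unit: "\<And>u. u \<in> X \<Longrightarrow> norm2 V u = 1 \<Longrightarrow> c \<le> Re (inner_G V (T u) u)"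
    and f: "f \<in> X"
  shows "c * Re (inner_G V f f) \<le> Re (inner_G V (T f) f)"
proof (cases "f = 0")
  case True
  then show ?thesis using cpair.linear_0[OF T(1)] by simp
next
  case False
  obtain u r where u: "u \<in> X" "norm2 V u = 1" "f = cscale (complex_of_real r) u"
    "r\<^sup>2 = Re (inner_G V f f)" using unit_multiple[OF X f False] by metis
  have "Re (inner_G V (T f) f) = r\<^sup>2 * Re (inner_G V (T u) u)"
    unfolding u(3) by (rule quadratic_form_scale) (use u X T in auto)
  also have "\<dots> \<ge> r\<^sup>2 * c" using unit[OF u(1,2)] by (simp add: mult_left_mono)
  finally show ?thesis using u(4) by (simp add: mult.commute)
qed

section \<open>Orthonormal sets\<close>

definition orthonormal :: "'a set \<Rightarrow> ('a \<Rightarrow> complex) set \<Rightarrow> bool" where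
  "orthonormal V S \<longleftrightarrow> finite S \<and> S \<subseteq> C0 V \<and>
     (\<forall>s\<in>S. \<forall>t\<in>S. inner_G V s t = (if s = t then 1 else 0))"

lemma orthonormal_coefficient:
  assumes "orthonormal V S" "t \<in> S"
  shows "inner_G V (\<Sum>s\<in>S. cscale (c s) s) t = c t"
proof -
  have "inner_G V (\<Sum>s\<in>S. cscale (c s) s) t = (\<Sum>s\<in>S. inner_G V (cscale (c s) s) t)"
    using assms by (intro inner_G_sum_left) (auto simp: orthonormal_def intro: cfun.subspace_scale[OF C0_subspace])
  also have "\<dots> = (\<Sum>s\<in>S. if s = t then c t else 0)"
    using assms by (intro sum.cong) (auto simp: orthonormal_def inner_G_scale_left subset_iff)
  also have "\<dots> = c t" using assms by (simp add: orthonormal_def)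
  finally show ?thesis .
qed

lemma orthonormal_expansion:
  assumes "orthonormal V S" "f \<in> cfun.span S"
  shows "f = (\<Sum>s\<in>S. cscale (inner_G V f s) s)"
proof -
  obtain c where c: "f = (\<Sum>s\<in>S. cscale (c s) s)"
    using assms cfun.span_finite[of S] by (auto simp: orthonormal_def)
  then have "inner_G V f t = c t" if "t \<in> S" for t
    using orthonormal_coefficient[OF assms(1) that] by simp
  then have "(\<Sum>s\<in>S. cscale (inner_G V f s) s) = (\<Sum>s\<in>S. cscale (c s) s)"
    by (intro sum.cong) auto
  then show ?thesis using c by metis
qed

lemma orthonormal_independent:
  assumes "orthonormal V S" shows "cfun.independent S"
proof -
  have "c t = 0" if "(\<Sum>s\<in>S. cscale (c s) s) = 0" "t \<in> S" for c t
    using orthonormal_coefficient[OF assms that(2), of c] that(1) by simp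
  moreover have "finite S" using assms by (simp add: orthonormal_def)
  ultimately show ?thesis by (auto simp: cfun.dependent_finite)
qed

lemma orthonormal_subset: "orthonormal V S \<Longrightarrow> S' \<subseteq> S \<Longrightarrow> orthonormal V S'"
  unfolding orthonormal_def by (metis finite_subset subsetD order_trans)

lemma orthonormal_span_C0: "orthonormal V S \<Longrightarrow> cfun.span S \<subseteq> C0 V"
  by (simp add: orthonormal_def cfun.span_minimal C0_subspace)

lemma orthonormal_insert:
  assumes S: "orthonormal V S" and u: "u \<in> C0 V" "norm2 V u = 1"
    and orth: "\<And>s. s \<in> S \<Longrightarrow> inner_G V u s = 0"
  shows "orthonormal V (insert u S)" "u \<notin> S"
proof -
  have uu: "inner_G V u u = 1"
    using u(2) inner_G_self_real[of V u] by (simp add: norm2_eq_1_iff complex_eq_iff)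
  moreover have "inner_G V s u = 0" if "s \<in> S" for s
    using orth[OF that] inner_G_commute[of V s u] by simp
  ultimately show "u \<notin> S" "orthonormal V (insert u S)"
    using assms by (auto simp: orthonormal_def)
qed

section \<open>The spectral theorem in finite dimensions\<close>

text \<open>Take an orthonormal set of eigenvectors in \<open>M\<close> of maximal cardinality. By symmetry its orthogonal
complement in \<open>M\<close> is invariant; an eigenvector in there could be added, so the complement is zero.

The existence of eigenvectors is a hypothesis because the lemma is used twice. For \<open>T = id\<close> the
hypothesis is trivial and the result is the existence of orthonormal bases; these are then used to
prove the hypothesis for every symmetric operator.\<close>

lemma eigenbasis_if_eigenvectors:
  assumes M: "cfun.subspace M" "M \<subseteq> cfun.span B" "finite B" "B \<subseteq> C0 V"
    and T: "clinear T" "T ` M \<subseteq> M" "symmetric_on V M T"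
    and ev: "\<And>N. cfun.subspace N \<Longrightarrow> N \<subseteq> M \<Longrightarrow> N \<noteq> {0} \<Longrightarrow> T ` N \<subseteq> N \<Longrightarrow>
      \<exists>f\<in>N. f \<noteq> 0 \<and> (\<exists>\<mu>::real. T f = cscale (of_real \<mu>) f)"
  obtains S \<mu> where "orthonormal V S" "cfun.span S = M"
    "\<And>s. s \<in> S \<Longrightarrow> T s = cscale (complex_of_real (\<mu> s)) s"
proof -
  define P where "P S \<longleftrightarrow> orthonormal V S \<and> S \<subseteq> M \<and>
    (\<forall>s\<in>S. \<exists>\<mu>::real. T s = cscale (of_real \<mu>) s)" for S
  have MC: "M \<subseteq> C0 V"
    using M(2,4) cfun.span_minimal[OF _ C0_subspace] by blast
  have "P {}" by (simp add: P_def orthonormal_def)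
  moreover have "card S \<le> card B" if "P S" for S
    using that cfun.independent_span_bound[OF M(3), of S] M(2) orthonormal_independent
    unfolding P_def by blast
  ultimately obtain S where S: "P S" "\<And>S'. P S' \<Longrightarrow> card S' \<le> card S"
    using ex_has_greatest_nat[of P "{}" card "card B + 1"] by (metis less_Suc_eq_le Suc_eq_plus1)
  have on: "orthonormal V S" and SM: "S \<subseteq> M" and fin: "finite S" and SC: "S \<subseteq> C0 V"
    using S(1) by (auto simp: P_def orthonormal_def)
  define N where "N = {f \<in> M. \<forall>s\<in>S. inner_G V f s = 0}"
  have N: "cfun.subspace N"
    using M(1) MC by (auto simp: N_def cfun.subspace_def inner_G_add_left inner_G_scale_left subset_iff)
  have inv: "T ` N \<subseteq> N"
  proof (clarsimp simp: N_def, intro conjI ballI)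
    fix f assume f: "f \<in> M" "\<forall>s\<in>S. inner_G V f s = 0"
    then show "T f \<in> M" using T(2) by auto
    fix s assume s: "s \<in> S"
    then obtain \<mu> :: real where "T s = cscale (of_real \<mu>) s" using S(1) by (auto simp: P_def)
    then show "inner_G V (T f) s = 0"
      using T(3) f s SM SC by (auto simp: symmetric_on_def inner_G_scale_right subset_iff)
  qed
  have N0: "N = {0}"
  proof (rule ccontr)
    assume "N \<noteq> {0}"
    then obtain f \<mu> where f: "f \<in> N" "f \<noteq> 0" "T f = cscale (complex_of_real \<mu>) f"
      using ev[OF N _ _ inv] by (auto simp: N_def)
    have "cfun.span {f} \<subseteq> C0 V"
      using f(1) MC by (intro cfun.span_minimal[OF _ C0_subspace]) (auto simp: N_def)
    then obtain u where u: "u \<in> cfun.span {f}" "norm2 V u = 1"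
      using unit_multiple[OF cfun.subspace_span _ cfun.span_base f(2)] by blast
    then obtain k where k: "u = cscale k f" by (auto simp: cfun.span_singleton)
    have uN: "u \<in> N" using f(1) N k cfun.subspace_scale by blast
    have "T u = cscale (complex_of_real \<mu>) u"
      unfolding k cpair.linear_scale[OF T(1)] f(3) by (simp add: fun_eq_iff)
    moreover have "orthonormal V (insert u S)" "u \<notin> S"
      using orthonormal_insert[OF on _ u(2)] uN MC by (auto simp: N_def)
    ultimately have "P (insert u S)" using S(1) uN by (auto simp: P_def N_def)
    from S(2)[OF this] fin \<open>u \<notin> S\<close> show False by simp
  qed
  have "cfun.span S = M"
  proof
    show "cfun.span S \<subseteq> M" using SM M(1) by (simp add: cfun.span_minimal)
    show "M \<subseteq> cfun.span S"
    proof
      fix f assume f: "f \<in> M"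
      define p where "p = (\<Sum>s\<in>S. cscale (inner_G V f s) s)"
      have p: "p \<in> cfun.span S"
        unfolding p_def by (intro cfun.span_sum cfun.span_scale cfun.span_base)
      have pM: "p \<in> M" using p SM M(1) cfun.span_minimal by blast
      have "f - p \<in> N"
        using f pM MC M(1) orthonormal_coefficient[OF on]
        by (auto simp: N_def cfun.subspace_diff inner_G_diff_left subset_iff p_def)
      then have "f = p" using N0 by simp
      then show "f \<in> cfun.span S" using p by simp
    qed
  qed
  moreover obtain \<mu> where "\<And>s. s \<in> S \<Longrightarrow> T s = cscale (complex_of_real (\<mu> s)) s"
    using S(1) unfolding P_def by metis
  ultimately show ?thesis using that on by blast
qed

lemma orthonormal_basis_exists:
  assumes M: "cfun.subspace M" "M \<subseteq> cfun.span B" "finite B" "B \<subseteq> C0 V"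
  obtains S where "orthonormal V S" "cfun.span S = M"
proof -
  have "\<exists>f\<in>N. f \<noteq> 0 \<and> (\<exists>\<mu>::real. f = cscale (of_real \<mu>) f)"
    if "cfun.subspace N" "N \<noteq> {0}" for N :: "('a \<Rightarrow> complex) set"
  proof -
    obtain f where "f \<in> N" "f \<noteq> 0" 
      using cfun.subspace_0[OF \<open>cfun.subspace N\<close>] \<open>N \<noteq> {0}\<close> by blast
    moreover have "f = cscale (of_real 1) f" by (simp add: fun_eq_iff)
    ultimately show ?thesis by blast
  qed
  note ev = this
  show ?thesis
  proof (rule eigenbasis_if_eigenvectors[OF M, of "\<lambda>f. f"])
    show "clinear (\<lambda>f :: 'a \<Rightarrow> complex. f)" by (intro clinearI) simp_all
    show "symmetric_on V M (\<lambda>f. f)" by (simp add: symmetric_on_def)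
    show "(\<lambda>f. f) ` M \<subseteq> M" by simp
  next
    fix S assume "orthonormal V S" "cfun.span S = M"
    then show thesis by (rule that)
  qed (rule ev)
qed


text \<open>In coordinates with respect to an orthonormal set the quadratic form is a polynomial in finitely many
complex numbers and their conjugates, hence continuous.\<close>

lemma quadratic_form_in_coordinates:
  assumes S: "orthonormal V S" and T: "clinear T" "T ` cfun.span S \<subseteq> C0 V"
  defines "L c \<equiv> \<Sum>s\<in>S. cscale (c s) s"
  shows "inner_G V (T (L c)) (L c) = (\<Sum>s\<in>S. c s * cnj (\<Sum>t\<in>S. c t * inner_G V t (T s)))"
proof -
  have SC: "S \<subseteq> C0 V" using S by (simp add: orthonormal_def)
  have TS: "T s \<in> C0 V" if "s \<in> S" for s using that T(2) by (auto intro: cfun.span_base)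
  have *: "inner_G V (T s) (L c) = cnj (\<Sum>t\<in>S. c t * inner_G V t (T s))" for s
  proof -
    have "inner_G V (L c) (T s) = (\<Sum>t\<in>S. inner_G V (cscale (c t) t) (T s))"
      unfolding L_def using SC by (intro inner_G_sum_left) (auto intro: cfun.subspace_scale[OF C0_subspace])
    also have "\<dots> = (\<Sum>t\<in>S. c t * inner_G V t (T s))"
      using SC by (intro sum.cong) (auto simp: inner_G_scale_left)
    finally show ?thesis using inner_G_commute by metis
  qed
  have "T (L c) = (\<Sum>s\<in>S. cscale (c s) (T s))"
    unfolding L_def by (simp only: cpair.linear_sum[OF T(1)] cpair.linear_scale[OF T(1)])
  then have "inner_G V (T (L c)) (L c) = (\<Sum>s\<in>S. inner_G V (cscale (c s) (T s)) (L c))"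
    using TS by (simp only:) (intro inner_G_sum_left, auto intro: cfun.subspace_scale[OF C0_subspace])
  also have "\<dots> = (\<Sum>s\<in>S. c s * inner_G V (T s) (L c))"
    using TS by (intro sum.cong) (auto simp: inner_G_scale_left)
  finally show ?thesis by (simp only: *)
qed

lemma eigenbasis_quadratic_form:
  assumes S: "orthonormal V S" and T: "clinear T"
    and ev: "\<And>s. s \<in> S \<Longrightarrow> T s = cscale (complex_of_real (\<mu> s)) s" and f: "f \<in> cfun.span S"
  shows "Re (inner_G V (T f) f) = (\<Sum>s\<in>S. \<mu> s * (cmod (inner_G V f s))\<^sup>2)"
proof -
  have SC: "S \<subseteq> C0 V" using S by (simp add: orthonormal_def)
  have sp: "T ` cfun.span S \<subseteq> C0 V"
  proof -
    have "T ` S \<subseteq> cfun.span S" using ev by (auto intro: cfun.span_scale cfun.span_base)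
    then have "cfun.span (T ` S) \<subseteq> cfun.span S" by (simp add: cfun.span_minimal)
    then show ?thesis using cpair.linear_span_image[OF T, of S] orthonormal_span_C0[OF S] by simp
  qed
  have eq: "f = (\<Sum>s\<in>S. cscale (inner_G V f s) s)" by (rule orthonormal_expansion[OF S f])
  define c where "c = inner_G V f"
  have f_eq: "f = (\<Sum>s\<in>S. cscale (c s) s)" using eq by (simp only: c_def)
  have "inner_G V (T f) f = (\<Sum>s\<in>S. c s * cnj (\<Sum>t\<in>S. c t * inner_G V t (T s)))"
    unfolding f_eq by (rule quadratic_form_in_coordinates[OF S T sp])
  also have "\<dots> = (\<Sum>s\<in>S. c s * cnj (of_real (\<mu> s) * c s))"
  proof (intro sum.cong refl)
    fix s assume s: "s \<in> S"
    have "(\<Sum>t\<in>S. c t * inner_G V t (T s)) = (\<Sum>t\<in>S. if t = s then c t * of_real (\<mu> s) else 0)"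
      using s S SC by (intro sum.cong) (auto simp: ev inner_G_scale_right orthonormal_def subset_iff)
    also have "\<dots> = of_real (\<mu> s) * c s" using S s by (simp add: orthonormal_def)
    finally show "c s * cnj (\<Sum>t\<in>S. c t * inner_G V t (T s)) = c s * cnj (of_real (\<mu> s) * c s)" by simp
  qed
  also have "Re \<dots> = (\<Sum>s\<in>S. \<mu> s * (cmod (c s))\<^sup>2)"
    unfolding Re_sum 
    by (intro sum.cong refl, simp only: cmod_power2) (simp add: power2_eq_square algebra_simps)
  finally show ?thesis by (simp add: c_def)
qed

lemma Parseval:
  assumes "orthonormal V S" "f \<in> cfun.span S"
  shows "Re (inner_G V f f) = (\<Sum>s\<in>S. (cmod (inner_G V f s))\<^sup>2)"
proof -
  have lin: "clinear (\<lambda>f :: 'a \<Rightarrow> complex. f)" by (intro clinearI) simp_all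
  have one: "s = cscale (complex_of_real 1) s" for s :: "'a \<Rightarrow> complex" by (simp add: fun_eq_iff)
  show ?thesis
    using eigenbasis_quadratic_form[OF assms(1) lin one assms(2)] by simp
qed

text \<open>In coordinates the unit sphere becomes \<open>K\<close> below, a compact set by Tychonoff's theorem: coordinates
outside \<open>S\<close> are pinned to 0, so that \<open>K\<close> lives in a full function space with the product topology.\<close>

lemma quadratic_form_attains_max:
  assumes S: "orthonormal V S" "S \<noteq> {}" and T: "clinear T" "T ` cfun.span S \<subseteq> C0 V"
  obtains f where "f \<in> cfun.span S" "norm2 V f = 1"
    "\<And>g. g \<in> cfun.span S \<Longrightarrow> norm2 V g = 1 \<Longrightarrow> Re (inner_G V (T g) g) \<le> Re (inner_G V (T f) f)"
proof -
  define L where "L c = (\<Sum>s\<in>S. cscale (c s) s)" for c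
  define \<phi> where "\<phi> c = Re (\<Sum>s\<in>S. c s * cnj (\<Sum>t\<in>S. c t * inner_G V t (T s)))"
    for c :: "('a \<Rightarrow> complex) \<Rightarrow> complex"
  have form: "Re (inner_G V (T (L c)) (L c)) = \<phi> c" for c
    using quadratic_form_in_coordinates[OF S(1) T, of c] by (simp only: \<phi>_def L_def)
  have Lspan: "L c \<in> cfun.span S" for c
    unfolding L_def by (intro cfun.span_sum cfun.span_scale cfun.span_base)
  have Lcoef: "inner_G V (L c) s = c s" if "s \<in> S" for c s
    unfolding L_def by (rule orthonormal_coefficient[OF S(1) that])
  have Lnorm: "norm2 V (L c) = 1 \<longleftrightarrow> (\<Sum>s\<in>S. (cmod (c s))\<^sup>2) = 1" for c
    unfolding norm2_eq_1_iff Parseval[OF S(1) Lspan] by (simp add: Lcoef)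
  have fin: "finite S" using S by (simp add: orthonormal_def)
  define B where "B = (\<lambda>s. if s \<in> S then cball 0 1 else {0 :: complex})"
  define K where "K = Pi\<^sub>E UNIV B \<inter> {c. (\<Sum>s\<in>S. (cmod (c s))\<^sup>2) = 1}"
  have "compactin (product_topology (\<lambda>_. euclidean) UNIV) (Pi\<^sub>E UNIV B)"
    unfolding compactin_PiE by (simp add: B_def)
  then have "compact (Pi\<^sub>E UNIV B)" by (simp add: euclidean_product_topology)
  moreover have "closed {c :: ('a \<Rightarrow> complex) \<Rightarrow> complex. (\<Sum>s\<in>S. (cmod (c s))\<^sup>2) = 1}"
    by (intro closed_Collect_eq continuous_intros continuous_on_product_coordinates)
  ultimately have "compact K" unfolding K_def by (rule compact_Int_closed)
  moreover have "K \<noteq> {}"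
  proof -
    obtain s0 where "s0 \<in> S" using S(2) by blast
    define e where "e s = (if s = s0 then 1 else 0 :: complex)" for s
    have "(\<Sum>s\<in>S. (cmod (e s))\<^sup>2) = (\<Sum>s\<in>S. if s = s0 then 1 else 0)"
      by (intro sum.cong) (auto simp: e_def)
    then have "e \<in> K"
      using fin \<open>s0 \<in> S\<close> by (auto simp: K_def B_def PiE_UNIV_domain e_def)
    then show ?thesis by blast
  qed
  moreover have "continuous_on K \<phi>"
    unfolding \<phi>_def by (intro continuous_intros continuous_on_subset[OF continuous_on_product_coordinates]) auto
  ultimately obtain c where c: "c \<in> K" "\<And>d. d \<in> K \<Longrightarrow> \<phi> d \<le> \<phi> c"
    using continuous_attains_sup[of K \<phi>] by blast
  show ?thesis
  proof (rule that[of "L c"])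
    show "L c \<in> cfun.span S" by (rule Lspan)
    show "norm2 V (L c) = 1" using c(1) by (simp add: Lnorm K_def)
    fix g assume g: "g \<in> cfun.span S" "norm2 V g = 1"
    define d where "d s = (if s \<in> S then inner_G V g s else 0)" for s
    have "g = (\<Sum>s\<in>S. cscale (inner_G V g s) s)" by (rule orthonormal_expansion[OF S(1) g(1)])
    also have "\<dots> = L d" unfolding L_def by (intro sum.cong) (auto simp: d_def)
    finally have gL: "g = L d" .
    have nd: "(\<Sum>s\<in>S. (cmod (d s))\<^sup>2) = 1" using g(2) Lnorm gL by simp
    have "cmod (d s) \<le> 1" if "s \<in> S" for s
    proof -
      have "(cmod (d s))\<^sup>2 \<le> 1"
        using member_le_sum[OF that, of "\<lambda>s. (cmod (d s))\<^sup>2"] fin nd by simp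
      then show ?thesis by (simp add: power_le_one_iff abs_le_square_iff)
    qed
    then have "d \<in> K" using nd by (auto simp: K_def B_def PiE_UNIV_domain d_def)
    then show "Re (inner_G V (T g) g) \<le> Re (inner_G V (T (L c)) (L c))"
      unfolding gL form by (rule c(2))
  qed
qed

text \<open>Used with \<open>(a, b) = (-1, \<mu>)\<close> for \<open>\<mu> - T\<close> at the top of the spectrum, and with \<open>(a, b) = (1, -L)\<close> for \<open>T - L\<close>
at the bottom.\<close>

lemma affine_operator:
  fixes a b :: real
  assumes X: "cfun.subspace X" "X \<subseteq> C0 V" and T: "clinear T" "T ` X \<subseteq> X" "symmetric_on V X T"
  defines "R \<equiv> \<lambda>g. cscale (of_real a) (T g) + cscale (of_real b) g"
  shows "clinear R" "R ` X \<subseteq> X" "symmetric_on V X R"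
    and "\<And>g h. g \<in> X \<Longrightarrow> inner_G V (R g) h = of_real a * inner_G V (T g) h + of_real b * inner_G V g h"
proof -
  show "clinear R"
    unfolding R_def
    by (intro clinearI)
      (simp_all add: cpair.linear_add[OF T(1)] cpair.linear_scale[OF T(1)] fun_eq_iff algebra_simps)
  show "R ` X \<subseteq> X"
    using X(1) T(2) by (auto simp: R_def intro!: cfun.subspace_add cfun.subspace_scale)
  show *: "inner_G V (R g) h = of_real a * inner_G V (T g) h + of_real b * inner_G V g h"
    if "g \<in> X" for g h
  proof -
    have C: "T g \<in> C0 V" "g \<in> C0 V" using that X(2) T(2) by auto
    show ?thesis
      unfolding R_def
      using C by (simp only: inner_G_add_left inner_G_scale_left cfun.subspace_scale[OF C0_subspace])
  qed
  show "symmetric_on V X R"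
    unfolding symmetric_on_def
  proof (intro ballI)
    fix g h assume gh: "g \<in> X" "h \<in> X"
    have "inner_G V g (R h) = cnj (inner_G V (R h) g)" by (rule inner_G_commute)
    also have "\<dots> = of_real a * cnj (inner_G V (T h) g) + of_real b * cnj (inner_G V h g)"
      by (simp add: *[OF gh(2)])
    also have "\<dots> = of_real a * inner_G V g (T h) + of_real b * inner_G V g h"
      using inner_G_commute by metis
    also have "\<dots> = inner_G V (R g) h"
      using gh T(3) by (simp add: * symmetric_on_def)
    finally show "inner_G V (R g) h = inner_G V g (R h)" by simp
  qed
qed

text \<open>A maximizer \<open>f\<close> of the quadratic form on the unit sphere, with maximum \<open>\<mu>\<close>, is an eigenvector: the operator
\<open>R = \<mu> - T\<close> is nonnegative and its form vanishes at \<open>f\<close>, so the Cauchy-Schwarz inequality for that form,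
tested on \<open>R f\<close>, gives \<open>R f = 0\<close>.\<close>

lemma symmetric_eigenvector_exists:
  assumes N: "cfun.subspace N" "N \<subseteq> cfun.span B" "finite B" "B \<subseteq> C0 V" "N \<noteq> {0}"
    and T: "clinear T" "T ` N \<subseteq> N" "symmetric_on V N T"
  shows "\<exists>f\<in>N. f \<noteq> 0 \<and> (\<exists>\<mu>::real. T f = cscale (of_real \<mu>) f)"
proof -
  obtain S where S: "orthonormal V S" "cfun.span S = N"
    using orthonormal_basis_exists[OF N(1-4)] .
  have NC: "N \<subseteq> C0 V" using orthonormal_span_C0[OF S(1)] S(2) by simp
  have "S \<noteq> {}" using S(2) N(5) by auto
  then obtain f where f: "f \<in> N" "norm2 V f = 1"
    "\<And>g. g \<in> N \<Longrightarrow> norm2 V g = 1 \<Longrightarrow> Re (inner_G V (T g) g) \<le> Re (inner_G V (T f) f)"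
    using quadratic_form_attains_max[OF S(1) _ T(1)] S(2) T(2) NC by auto
  define \<mu> where "\<mu> = Re (inner_G V (T f) f)"
  define R where "R = (\<lambda>g. cscale (of_real (- 1)) (T g) + cscale (of_real \<mu>) g)"
  note R = affine_operator[OF N(1) NC T, where a = "- 1" and b = \<mu>, folded R_def]
  have RN: "R g \<in> N" if "g \<in> N" for g using that R(2) by auto
  have inR: "Re (inner_G V (R g) g) = \<mu> * Re (inner_G V g g) - Re (inner_G V (T g) g)" if "g \<in> N" for g
    unfolding R_def by (subst R(4)[OF that]) simp
  have pos: "0 \<le> Re (inner_G V (R g) g)" if g: "g \<in> N" for g
  proof -
    have "Re (inner_G V (T g) g) \<le> \<mu> * Re (inner_G V g g)"
      by (rule quadratic_form_upper_bound[OF N(1) NC T(1) _ _ g]) (use T(2) NC f(3) in \<open>auto simp: \<mu>_def\<close>)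
    then show ?thesis using inR[OF g] by simp
  qed
  have "(cmod (inner_G V (R f) (R f)))\<^sup>2 \<le> Re (inner_G V (R f) f) * Re (inner_G V (R (R f)) (R f))"
    by (rule Cauchy_Schwarz_operator[OF N(1) NC R(1) _ R(3) pos]) (use RN NC f(1) in auto)
  also have "Re (inner_G V (R f) f) = 0"
    using inR[OF f(1)] f(2) by (simp add: \<mu>_def norm2_eq_1_iff)
  finally have "R f = 0"
    using inner_G_self_eq_0[of "R f" V] RN[OF f(1)] NC by auto
  then have "T f = cscale (of_real \<mu>) f" by (auto simp: R_def fun_eq_iff)
  moreover have "f \<noteq> 0" using f(2) by (auto simp: norm2_eq_1_iff)
  ultimately show ?thesis using f(1) by blast
qed

theorem spectral_theorem:
  assumes M: "cfun.subspace M" "M \<subseteq> cfun.span B" "finite B" "B \<subseteq> C0 V"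
    and T: "clinear T" "T ` M \<subseteq> M" "symmetric_on V M T"
  obtains S \<mu> where "orthonormal V S" "cfun.span S = M"
    "\<And>s. s \<in> S \<Longrightarrow> T s = cscale (complex_of_real (\<mu> s)) s"
proof (rule eigenbasis_if_eigenvectors[OF M T])
  fix N assume N: "cfun.subspace N" "N \<subseteq> M" "N \<noteq> {0}" "T ` N \<subseteq> N"
  show "\<exists>f\<in>N. f \<noteq> 0 \<and> (\<exists>\<mu>::real. T f = cscale (of_real \<mu>) f)"
    by (rule symmetric_eigenvector_exists[OF N(1) _ M(3,4) N(3) T(1) N(4)])
      (use N(2) M(2) T(3) in \<open>auto simp: symmetric_on_def\<close>)
qed (use that in blast)


section \<open>The Courant-Fischer principle\<close>

lemma subspace_finite_basis:
  assumes M: "cfun.subspace M" "cfun.dim M = k" "k \<ge> 1"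
  obtains B where "finite B" "card B = k" "B \<subseteq> M" "cfun.independent B" "cfun.span B = M"
proof -
  obtain B where B: "B \<subseteq> M" "cfun.independent B" "M \<subseteq> cfun.span B" "card B = cfun.dim M"
    by (rule cfun.basis_exists)
  then have "finite B" using M by (intro card_ge_0_finite) simp
  moreover have "cfun.span B = M" using B M(1) by (simp add: cfun.span_minimal subset_antisym)
  ultimately show ?thesis using that B M(2) by simp
qed

lemma finite_dim_common_support:
  assumes M: "cfun.subspace M" "M \<subseteq> C0 V" "cfun.dim M = k" "k \<ge> 1"
  obtains F where "finite F" "F \<subseteq> V" "M \<subseteq> functions_on F"
proof -
  obtain B where B: "finite B" "B \<subseteq> M" "cfun.span B = M"
    using subspace_finite_basis[OF M(1,3,4)] by metis
  define F where "F = (\<Union>b\<in>B. {x. b x \<noteq> 0})"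
  have "finite F" "F \<subseteq> V" using B(1,2) M(2) by (auto simp: F_def C0_def functions_on_def)
  moreover have "M \<subseteq> functions_on F"
    unfolding B(3)[symmetric]
    by (intro cfun.span_minimal functions_on_subspace) (auto simp: F_def functions_on_def)
  ultimately show ?thesis using that by blast
qed

text \<open>Otherwise the orthogonal projection onto the span of \<open>N\<close> would be injective on \<open>M\<close> and map a basis of \<open>M\<close> to
more than \<open>card N\<close> independent vectors in that span.\<close>

lemma orthogonal_vector_exists:
  assumes M: "cfun.subspace M" "M \<subseteq> C0 V" "cfun.dim M = k"
    and N: "orthonormal V N" "card N < k"
  obtains f where "f \<in> M" "f \<noteq> 0" "\<And>s. s \<in> N \<Longrightarrow> inner_G V f s = 0"
proof -
  have k: "k \<ge> 1" using N(2) by simp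
  obtain B where B: "finite B" "card B = k" "B \<subseteq> M" "cfun.independent B" "cfun.span B = M"
    using subspace_finite_basis[OF M(1,3) k] .
  obtain F where F: "finite F" "F \<subseteq> V" "M \<subseteq> functions_on F"
    using finite_dim_common_support[OF M k] .
  \<comment> \<open>The sum over \<open>F\<close> replaces the inner product to make \<open>P\<close> linear on all functions, not only on finitely supported ones.\<close>
  define P where "P f = (\<Sum>s\<in>N. cscale (\<Sum>x\<in>F. f x * cnj (s x)) s)" for f
  have Pin: "P f = (\<Sum>s\<in>N. cscale (inner_G V f s) s)" if "f \<in> M" for f
    using that F unfolding P_def by (intro sum.cong refl) (subst inner_G_eq_sum[OF F(1,2)], auto)
  have lin: "clinear P"
    by (intro clinearI) (simp_all add: P_def fun_eq_iff sum_fun_apply sum.distrib sum_distrib_left sum_distrib_right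
        algebra_simps)
  have "\<exists>f\<in>M. f \<noteq> 0 \<and> (\<forall>s\<in>N. inner_G V f s = 0)"
  proof (rule ccontr)
    assume neg: "\<not> ?thesis"
    have "inj_on P M"
    proof (rule inj_onI)
      fix f g assume fg: "f \<in> M" "g \<in> M" "P f = P g"
      have fgM: "f - g \<in> M" using fg M(1) by (simp add: cfun.subspace_diff)
      have "P (f - g) = 0" using fg(3) by (simp add: cpair.linear_diff[OF lin])
      then have "inner_G V (f - g) s = 0" if "s \<in> N" for s
        using orthonormal_coefficient[OF N(1) that, of "inner_G V (f - g)"] Pin[OF fgM] by simp
      then have "f - g = 0" using neg fgM by blast
      then show "f = g" by simp
    qed
    then have "inj_on P (cfun.span B)" "inj_on P B"
      using B(3,5) by (auto intro: inj_on_subset)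
    then have ind: "cfun.independent (P ` B)" "card (P ` B) = k"
      using cpair.linear_independent_injective_image[OF lin B(4)] B(2) by (auto simp: card_image)
    have "P f \<in> cfun.span N" for f
      unfolding P_def by (intro cfun.span_sum cfun.span_scale cfun.span_base)
    then have "P ` B \<subseteq> cfun.span N" by blast
    then have "card (P ` B) \<le> card N"
      using cfun.independent_span_bound[OF _ ind(1)] N(1) by (simp add: orthonormal_def)
    then show False using ind(2) N(2) by simp
  qed
  then show ?thesis using that by blast
qed

text \<open>These two counts are all that the minimax argument needs to know about the \<open>k\<close>-th smallest eigenvalue
counted with multiplicity.\<close>

lemma nth_smallest_value_counts:
  fixes \<mu> :: "'b \<Rightarrow> real"
  assumes S: "finite S" and k: "1 \<le> k" "k \<le> card S"
  defines "L \<equiv> sorted_list_of_multiset (image_mset \<mu> (mset_set S))"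
  shows "k \<le> card {s\<in>S. \<mu> s \<le> L ! (k - 1)}" and "card {s\<in>S. \<mu> s < L ! (k - 1)} < k"
proof -
  have len: "length L = card S"
    unfolding L_def by (metis mset_sorted_list_of_multiset size_image_mset size_mset size_mset_set)
  have sorted: "L ! i \<le> L ! j" if "i \<le> j" "j < length L" for i j
    using that by (simp add: L_def sorted_nth_mono sorted_sorted_list_of_multiset)
  have cnt: "card {s\<in>S. P (\<mu> s)} = card {i. i < length L \<and> P (L ! i)}" for P
  proof -
    have "card {s\<in>S. P (\<mu> s)} = size (filter_mset P (image_mset \<mu> (mset_set S)))"
      using S by (simp add: filter_mset_image_mset filter_mset_mset_set)
    also have "\<dots> = length (filter P L)"
      by (metis L_def mset_filter mset_sorted_list_of_multiset size_mset)
    finally show ?thesis by (simp add: length_filter_conv_card)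
  qed
  have "{..<k} \<subseteq> {i. i < length L \<and> L ! i \<le> L ! (k - 1)}"
    using k len by (auto intro!: sorted)
  then have "card {..<k} \<le> card {i. i < length L \<and> L ! i \<le> L ! (k - 1)}"
    by (intro card_mono) auto
  then show "k \<le> card {s\<in>S. \<mu> s \<le> L ! (k - 1)}"
    using cnt[of "\<lambda>x. x \<le> L ! (k - 1)"] by simp
  have "i < k - 1" if "i < length L" "L ! i < L ! (k - 1)" for i
    using sorted[of "k - 1" i] that by fastforce
  then have "card {i. i < length L \<and> L ! i < L ! (k - 1)} \<le> card {..<k - 1}"
    by (intro card_mono) auto
  then show "card {s\<in>S. \<mu> s < L ! (k - 1)} < k"
    using k(1) cnt[of "\<lambda>x. x < L ! (k - 1)"] by simp
qed

text \<open>The span of \<open>k\<close> eigenvectors with eigenvalue at most \<open>\<kappa>\<close> realizes the upper bound. For the lower bound,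
fewer than \<open>k\<close> members of \<open>S\<close> have an eigenvalue below \<open>\<kappa>\<close>, so every \<open>k\<close>-dimensional \<open>M\<close> contains a unit vector
orthogonal to all of them.\<close>

lemma Courant_Fischer:
  assumes S: "orthonormal V S" and T: "clinear T"
    and ev: "\<And>s. s \<in> S \<Longrightarrow> T s = cscale (complex_of_real (\<mu> s)) s"
    and k: "1 \<le> k" "k \<le> card S"
  defines "\<kappa> \<equiv> sorted_list_of_multiset (image_mset \<mu> (mset_set S)) ! (k - 1)"
  shows "\<exists>M. cfun.subspace M \<and> M \<subseteq> cfun.span S \<and> cfun.dim M = k \<and>
      (\<forall>f\<in>M. norm2 V f = 1 \<longrightarrow> Re (inner_G V (T f) f) \<le> \<kappa>)" (is ?upper)
    and "\<And>M. cfun.subspace M \<Longrightarrow> M \<subseteq> cfun.span S \<Longrightarrow> cfun.dim M = k \<Longrightarrow>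
      \<exists>f\<in>M. norm2 V f = 1 \<and> \<kappa> \<le> Re (inner_G V (T f) f)"
proof -
  have fin: "finite S" using S by (simp add: orthonormal_def)
  note counts = nth_smallest_value_counts[OF fin k, of \<mu>, folded \<kappa>_def]
  show ?upper
  proof -
    obtain S1 where S1: "S1 \<subseteq> {s\<in>S. \<mu> s \<le> \<kappa>}" "card S1 = k"
      using obtain_subset_with_card_n[OF counts(1)] by metis
    have on: "orthonormal V S1" using S S1(1) by (auto intro: orthonormal_subset)
    have "Re (inner_G V (T f) f) \<le> \<kappa>" if f: "f \<in> cfun.span S1" "norm2 V f = 1" for f
    proof -
      have "Re (inner_G V (T f) f) = (\<Sum>s\<in>S1. \<mu> s * (cmod (inner_G V f s))\<^sup>2)"
        by (rule eigenbasis_quadratic_form[OF on T _ f(1)]) (use S1 ev in auto)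
      also have "\<dots> \<le> (\<Sum>s\<in>S1. \<kappa> * (cmod (inner_G V f s))\<^sup>2)"
        using S1(1) by (intro sum_mono mult_right_mono) auto
      also have "\<dots> = \<kappa>"
        using f(2) Parseval[OF on f(1)] by (simp add: norm2_eq_1_iff flip: sum_distrib_left)
      finally show ?thesis .
    qed
    moreover have "cfun.span S1 \<subseteq> cfun.span S" using S1(1) by (intro cfun.span_mono) auto
    moreover have "cfun.dim (cfun.span S1) = k"
      using cfun.dim_span_eq_card_independent[OF orthonormal_independent[OF on]] S1(2) by simp
    ultimately show ?thesis by (intro exI[of _ "cfun.span S1"]) auto
  qed
  fix M assume M: "cfun.subspace M" "M \<subseteq> cfun.span S" "cfun.dim M = k"
  have MC: "M \<subseteq> C0 V" using M(2) orthonormal_span_C0[OF S] by blast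
  have low: "orthonormal V {s\<in>S. \<mu> s < \<kappa>}" by (rule orthonormal_subset[OF S]) auto
  obtain f where f: "f \<in> M" "f \<noteq> 0" "\<And>s. s \<in> {s\<in>S. \<mu> s < \<kappa>} \<Longrightarrow> inner_G V f s = 0"
    using orthogonal_vector_exists[OF M(1) MC M(3) low counts(2)] by blast
  obtain u r where u: "u \<in> M" "norm2 V u = 1" "f = cscale (complex_of_real r) u"
    using unit_multiple[OF M(1) MC f(1,2)] by metis
  have "r \<noteq> 0" using f(2) u(3) by (auto simp: cscale_def zero_fun_def)
  have orth: "inner_G V u s = 0" if "s \<in> S" "\<mu> s < \<kappa>" for s
    using f(3)[of s] that u MC \<open>r \<noteq> 0\<close> by (auto simp: inner_G_scale_left)
  have uS: "u \<in> cfun.span S" using u(1) M(2) by blast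
  have "\<kappa> = (\<Sum>s\<in>S. \<kappa> * (cmod (inner_G V u s))\<^sup>2)"
    using u(2) Parseval[OF S uS] by (simp add: norm2_eq_1_iff flip: sum_distrib_left)
  also have "\<dots> \<le> (\<Sum>s\<in>S. \<mu> s * (cmod (inner_G V u s))\<^sup>2)"
  proof (rule sum_mono)
    fix s assume "s \<in> S"
    then show "\<kappa> * (cmod (inner_G V u s))\<^sup>2 \<le> \<mu> s * (cmod (inner_G V u s))\<^sup>2"
      by (cases "\<mu> s < \<kappa>") (auto simp: orth intro: mult_right_mono)
  qed
  also have "\<dots> = Re (inner_G V (T u) u)"
    by (rule eigenbasis_quadratic_form[OF S T ev uS, symmetric])
  finally show "\<exists>f\<in>M. norm2 V f = 1 \<and> \<kappa> \<le> Re (inner_G V (T f) f)" using u by blast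
qed

lemma eigenspace_of_eigenbasis:
  assumes S: "orthonormal V S" and T: "clinear T"
    and ev: "\<And>s. s \<in> S \<Longrightarrow> T s = cscale (complex_of_real (\<mu> s)) s"
  shows "{f \<in> cfun.span S. T f = cscale (complex_of_real \<nu>) f} = cfun.span {s\<in>S. \<mu> s = \<nu>}"
proof
  show "cfun.span {s\<in>S. \<mu> s = \<nu>} \<subseteq> {f \<in> cfun.span S. T f = cscale (complex_of_real \<nu>) f}"
  proof (rule cfun.span_minimal)
    show "cfun.subspace {f \<in> cfun.span S. T f = cscale (complex_of_real \<nu>) f}"
      unfolding cfun.subspace_def
      by (auto simp: cpair.linear_0[OF T] cpair.linear_add[OF T] cpair.linear_scale[OF T]
          cfun.span_add cfun.span_scale cfun.span_zero fun_eq_iff algebra_simps)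
  qed (auto simp: ev cfun.span_base)
  show "{f \<in> cfun.span S. T f = cscale (complex_of_real \<nu>) f} \<subseteq> cfun.span {s\<in>S. \<mu> s = \<nu>}"
  proof clarify
    fix f assume f: "f \<in> cfun.span S" "T f = cscale (complex_of_real \<nu>) f"
    define c where "c = inner_G V f"
    have fin: "finite S" using S by (simp add: orthonormal_def)
    have eq: "f = (\<Sum>s\<in>S. cscale (c s) s)"
      using orthonormal_expansion[OF S f(1)] by (simp only: c_def)
    have "T f = (\<Sum>s\<in>S. cscale (c s) (T s))"
      by (subst eq) (simp only: cpair.linear_sum[OF T] cpair.linear_scale[OF T])
    also have "\<dots> = (\<Sum>s\<in>S. cscale (c s * of_real (\<mu> s)) s)"
      by (intro sum.cong) (auto simp: ev fun_eq_iff)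
    finally have Tf: "T f = (\<Sum>s\<in>S. cscale (c s * of_real (\<mu> s)) s)" .
    have "c s = 0" if "s \<in> S" "\<mu> s \<noteq> \<nu>" for s
    proof -
      have "c s * of_real (\<mu> s) = inner_G V (T f) s"
        unfolding Tf by (rule orthonormal_coefficient[OF S that(1), symmetric])
      also have "\<dots> = of_real \<nu> * c s"
        using f orthonormal_span_C0[OF S] by (auto simp: inner_G_scale_left c_def)
      finally show ?thesis using that(2) by (auto simp: mult.commute)
    qed
    then have "(\<Sum>s\<in>S. cscale (c s) s) = (\<Sum>s\<in>{s\<in>S. \<mu> s = \<nu>}. cscale (c s) s)"
      using fin by (intro sum.mono_neutral_right) (auto simp: fun_eq_iff)
    then have "f = (\<Sum>s\<in>{s\<in>S. \<mu> s = \<nu>}. cscale (c s) s)" using eq by simp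
    also have "\<dots> \<in> cfun.span {s\<in>S. \<mu> s = \<nu>}"
      by (intro cfun.span_sum cfun.span_scale cfun.span_base)
    finally show "f \<in> cfun.span {s\<in>S. \<mu> s = \<nu>}" .
  qed
qed

text \<open>The multiset of eigenvalues defined through the dimensions of the eigenspaces agrees with the one read
off from an eigenbasis. It connects the definition of the Dirichlet eigenvalues with \<open>Courant_Fischer\<close>.\<close>

lemma eigenvalue_multiset_of_eigenbasis:
  assumes S: "orthonormal V S" and T: "clinear T"
    and ev: "\<And>s. s \<in> S \<Longrightarrow> T s = cscale (complex_of_real (\<mu> s)) s"
  defines "Eig \<equiv> \<lambda>\<nu>. {f \<in> cfun.span S. T f = cscale (complex_of_real \<nu>) f}"
  shows "(\<Sum>\<nu>\<in>{\<nu>. \<exists>f\<in>Eig \<nu>. f \<noteq> 0}. replicate_mset (cfun.dim (Eig \<nu>)) \<nu>) = image_mset \<mu> (mset_set S)"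
proof -
  have fin: "finite S" using S by (simp add: orthonormal_def)
  have Eig: "Eig \<nu> = cfun.span {s\<in>S. \<mu> s = \<nu>}" for \<nu>
    unfolding Eig_def by (rule eigenspace_of_eigenbasis[OF S T ev])
  have dim: "cfun.dim (Eig \<nu>) = card {s\<in>S. \<mu> s = \<nu>}" for \<nu>
    unfolding Eig
    by (rule cfun.dim_span_eq_card_independent[OF orthonormal_independent[OF orthonormal_subset[OF S]]]) auto
  have spec: "{\<nu>. \<exists>f\<in>Eig \<nu>. f \<noteq> 0} = \<mu> ` S"
  proof (intro set_eqI iffI)
    fix \<nu> assume "\<nu> \<in> {\<nu>. \<exists>f\<in>Eig \<nu>. f \<noteq> 0}"
    then have "cfun.span {s\<in>S. \<mu> s = \<nu>} \<noteq> {0}" unfolding Eig by auto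
    then have "{s\<in>S. \<mu> s = \<nu>} \<noteq> {}" by (metis cfun.span_empty)
    then show "\<nu> \<in> \<mu> ` S" by auto
  next
    fix \<nu> assume "\<nu> \<in> \<mu> ` S"
    then obtain s where s: "s \<in> S" "\<mu> s = \<nu>" by auto
    have "inner_G V s s = 1" using S s(1) by (simp add: orthonormal_def)
    then have "s \<noteq> 0" by auto
    moreover have "s \<in> Eig \<nu>" unfolding Eig using s by (auto intro: cfun.span_base)
    ultimately show "\<nu> \<in> {\<nu>. \<exists>f\<in>Eig \<nu>. f \<noteq> 0}" by auto
  qed
  show ?thesis
    unfolding spec dim
  proof (rule multiset_eqI)
    fix x
    have "count (\<Sum>\<nu>\<in>\<mu> ` S. replicate_mset (card {s\<in>S. \<mu> s = \<nu>}) \<nu>) x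
        = (\<Sum>\<nu>\<in>\<mu> ` S. if \<nu> = x then card {s\<in>S. \<mu> s = x} else 0)"
      unfolding count_sum by (intro sum.cong) auto
    also have "\<dots> = card {s\<in>S. \<mu> s = x}"
      using fin by (auto simp: image_iff intro!: card_eq_0_iff[THEN iffD2, symmetric])
    also have "\<dots> = count (image_mset \<mu> (mset_set S)) x"
      using fin by (simp add: count_image_mset' conj_commute vimage_def Int_def eq_commute[of x])
    finally show "count (\<Sum>\<nu>\<in>\<mu> ` S. replicate_mset (card {s\<in>S. \<mu> s = \<nu>}) \<nu>) x
        = count (image_mset \<mu> (mset_set S)) x" .
  qed
qed

lemma functions_on_orthonormal_basis:
  assumes "finite W" "W \<subseteq> V"
  obtains D where "orthonormal V D" "cfun.span D = functions_on W" "card D = card W"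
proof -
  define \<delta> where "\<delta> w = (\<lambda>x. if x = w then 1 else 0 :: complex)" for w :: 'a
  have dW: "\<delta> w \<in> functions_on W" if "w \<in> W" for w using that by (auto simp: \<delta>_def functions_on_def)
  have inj: "inj_on \<delta> W" by (auto simp: inj_on_def \<delta>_def fun_eq_iff split: if_splits)
  have "inner_G V (\<delta> v) (\<delta> w) = (if \<delta> v = \<delta> w then 1 else 0)" if vw: "v \<in> W" "w \<in> W" for v w
  proof -
    have "inner_G V (\<delta> v) (\<delta> w) = (\<Sum>x\<in>W. if x = v then cnj (\<delta> w v) else 0)"
      unfolding inner_G_eq_sum[OF assms dW[OF vw(1)]] by (intro sum.cong) (auto simp: \<delta>_def)
    also have "\<dots> = cnj (\<delta> w v)" using assms vw by simp
    also have "\<dots> = (if \<delta> v = \<delta> w then 1 else 0)"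
      using inj vw by (auto simp: inj_on_eq_iff) (auto simp: \<delta>_def)
    finally show ?thesis .
  qed
  then have "orthonormal V (\<delta> ` W)"
    using assms dW functions_on_subset_C0[OF assms] by (auto simp: orthonormal_def)
  moreover have "cfun.span (\<delta> ` W) = functions_on W"
  proof
    show "cfun.span (\<delta> ` W) \<subseteq> functions_on W"
      using dW by (intro cfun.span_minimal functions_on_subspace) auto
    show "functions_on W \<subseteq> cfun.span (\<delta> ` W)"
    proof
      fix f :: "'a \<Rightarrow> complex" assume f: "f \<in> functions_on W"
      have "f = (\<Sum>w\<in>W. cscale (f w) (\<delta> w))"
        using f assms(1) by (auto simp: fun_eq_iff sum_fun_apply \<delta>_def functions_on_def if_distrib cong: if_cong)
      also have "\<dots> \<in> cfun.span (\<delta> ` W)"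
        by (intro cfun.span_sum cfun.span_scale cfun.span_base) auto
      finally show "f \<in> cfun.span (\<delta> ` W)" .
    qed
  qed
  ultimately show ?thesis using that card_image[OF inj] by blast
qed


section \<open>The Laplacian of a graph of bounded degree\<close>

abbreviation neg_laplacian :: "'a rel \<Rightarrow> ('a \<Rightarrow> complex) \<Rightarrow> ('a \<Rightarrow> complex)" where
  "neg_laplacian E \<equiv> \<lambda>g. - laplacian E g"

lemma neg_laplacian_linear: "clinear (neg_laplacian E)"
  by (intro clinearI)
    (simp_all add: laplacian_def fun_eq_iff sum_subtractf sum.distrib sum_distrib_left algebra_simps)

lemma funpow_linear:
  assumes "clinear T" shows "clinear (T ^^ n)"
proof (induction n)
  case (Suc n)
  show ?case
    by (intro clinearI) (simp_all only: funpow.simps comp_apply cpair.linear_add[OF Suc]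
        cpair.linear_scale[OF Suc] cpair.linear_add[OF assms] cpair.linear_scale[OF assms])
next
  case 0
  show ?case by (intro clinearI) (simp_all add: fun_eq_iff)
qed

lemma funpow_invariant: "(\<And>f. f \<in> X \<Longrightarrow> T f \<in> X) \<Longrightarrow> f \<in> X \<Longrightarrow> (T ^^ n) f \<in> X"
  by (induction n) auto

lemma funpow_symmetric:
  assumes "\<And>f. f \<in> X \<Longrightarrow> T f \<in> X" "symmetric_on V X T"
  shows "symmetric_on V X (T ^^ n)"
proof (induction n)
  case (Suc n)
  then show ?case
    using assms funpow_invariant[of X T] unfolding symmetric_on_def
    by (metis comp_apply funpow.simps(2) funpow_swap1)
qed (simp add: symmetric_on_def)

lemma neg_laplacian_power: "(neg_laplacian E ^^ n) f = cscale ((- 1) ^ n) ((laplacian E ^^ n) f)"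
proof (induction n)
  case (Suc n)
  have *: "neg_laplacian E (cscale c g) = cscale (- c) (laplacian E g)" for c g
    using cpair.linear_scale[OF neg_laplacian_linear, of E c g] by (simp add: fun_eq_iff)
  show ?case unfolding funpow.simps comp_apply Suc * by simp
qed (simp add: fun_eq_iff)

locale bounded_degree_graph =
  fixes V :: "'a set" and E :: "'a rel"
  assumes simple: "simple_graph V E" and loc_fin: "locally_finite V E"
    and bounded: "bdd_above (deg E ` V)"
begin

lemma sym_edge: "(x, y) \<in> E \<longleftrightarrow> (y, x) \<in> E"
  using simple by (auto simp: simple_graph_def sym_def)

lemma neighbors_outside: "x \<notin> V \<Longrightarrow> neighbors E x = {}"
  using simple by (auto simp: simple_graph_def neighbors_def)

lemma neighbors_subset: "neighbors E x \<subseteq> V"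
  using simple by (auto simp: simple_graph_def neighbors_def)

lemma finite_neighbors: "finite (neighbors E x)"
  using loc_fin neighbors_outside[of x] by (cases "x \<in> V") (auto simp: locally_finite_def)

lemma neg_laplacian_C0:
  assumes "f \<in> C0 V" shows "neg_laplacian E f \<in> C0 V"
proof -
  obtain S where S: "finite S" "S \<subseteq> V" "f \<in> functions_on S" using C0_support assms by metis
  define S' where "S' = S \<union> (\<Union>x\<in>S. neighbors E x)"
  have "laplacian E f x = 0" if "x \<notin> S'" for x
  proof -
    have "f y = 0" if "y \<in> neighbors E x" for y
      using that \<open>x \<notin> S'\<close> S(3) sym_edge by (auto simp: S'_def neighbors_def functions_on_def)
    moreover have "f x = 0" using that S(3) by (auto simp: S'_def functions_on_def)
    ultimately show ?thesis by (simp add: laplacian_def)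
  qed
  then have "neg_laplacian E f \<in> functions_on S'" by (simp add: functions_on_def)
  moreover have "finite S'" "S' \<subseteq> V"
    using S finite_neighbors neighbors_subset by (auto simp: S'_def)
  ultimately show ?thesis using functions_on_subset_C0 by blast
qed

lemma power_C0: "f \<in> C0 V \<Longrightarrow> (neg_laplacian E ^^ n) f \<in> C0 V"
  by (rule funpow_invariant[OF neg_laplacian_C0])

text \<open>Since \<open>f\<close> and \<open>g\<close> vanish outside \<open>S\<close>, only edges inside \<open>S\<close> contribute to the second sum, while the first one
keeps the full degrees. Symmetry of the operator can be read off from the symmetry of \<open>E\<close>.\<close>

lemma inner_neg_laplacian:
  assumes S: "finite S" "S \<subseteq> V" and f: "f \<in> functions_on S" and g: "g \<in> functions_on S"
  shows "inner_G V (neg_laplacian E f) g =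
    (\<Sum>x\<in>S. of_nat (deg E x) * f x * cnj (g x)) - (\<Sum>x\<in>S. \<Sum>y\<in>S. of_bool ((x, y) \<in> E) * f y * cnj (g x))"
proof -
  have "inner_G V (neg_laplacian E f) g = cnj (inner_G V g (neg_laplacian E f))"
    by (rule inner_G_commute)
  also have "\<dots> = (\<Sum>x\<in>S. neg_laplacian E f x * cnj (g x))"
    unfolding inner_G_eq_sum[OF S g] by (simp add: mult.commute)
  also have "\<dots> = (\<Sum>x\<in>S. of_nat (deg E x) * f x * cnj (g x) - (\<Sum>y\<in>S. of_bool ((x, y) \<in> E) * f y * cnj (g x)))"
  proof (intro sum.cong refl)
    fix x
    have "(\<Sum>y\<in>neighbors E x. f y) = (\<Sum>y\<in>neighbors E x \<inter> S. f y)"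
      using finite_neighbors f by (intro sum.mono_neutral_right) (auto simp: functions_on_def)
    also have "\<dots> = (\<Sum>y\<in>S. of_bool ((x, y) \<in> E) * f y)"
      using S(1) by (intro sum.mono_neutral_cong_left) (auto simp: neighbors_def)
    finally have "neg_laplacian E f x = of_nat (deg E x) * f x - (\<Sum>y\<in>S. of_bool ((x, y) \<in> E) * f y)"
      by (simp add: laplacian_def sum_subtractf deg_def)
    then show "neg_laplacian E f x * cnj (g x)
        = of_nat (deg E x) * f x * cnj (g x) - (\<Sum>y\<in>S. of_bool ((x, y) \<in> E) * f y * cnj (g x))"
      by (simp add: left_diff_distrib sum_distrib_right)
  qed
  finally show ?thesis by (simp add: sum_subtractf)
qed

lemma neg_laplacian_symmetric: "symmetric_on V (C0 V) (neg_laplacian E)"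
  unfolding symmetric_on_def
proof (intro ballI)
  fix f g assume "f \<in> C0 V" "g \<in> C0 V"
  then obtain S where S: "finite S" "S \<subseteq> V" "f \<in> functions_on S" "g \<in> functions_on S"
    using C0_common_support by metis
  have cnj_bool: "cnj (of_bool b) = of_bool b" for b by (cases b) auto
  have "inner_G V f (neg_laplacian E g) = cnj (inner_G V (neg_laplacian E g) f)"
    by (rule inner_G_commute)
  also have "\<dots> = (\<Sum>x\<in>S. of_nat (deg E x) * f x * cnj (g x))
      - (\<Sum>x\<in>S. \<Sum>y\<in>S. of_bool ((x, y) \<in> E) * f x * cnj (g y))"
    unfolding inner_neg_laplacian[OF S(1,2,4,3)] by (simp add: cnj_bool mult_ac)
  also have "(\<Sum>x\<in>S. \<Sum>y\<in>S. of_bool ((x, y) \<in> E) * f x * cnj (g y))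
      = (\<Sum>x\<in>S. \<Sum>y\<in>S. of_bool ((x, y) \<in> E) * f y * cnj (g x))"
    by (subst sum.swap) (simp add: sym_edge)
  finally show "inner_G V (neg_laplacian E f) g = inner_G V f (neg_laplacian E g)"
    unfolding inner_neg_laplacian[OF S] by (rule sym)
qed

text \<open>By \<open>2 |f(x)| |f(y)| \<le> |f(x)|\<^sup>2 + |f(y)|\<^sup>2\<close>, summed over the edges in \<open>S\<close>. It bounds the form of \<open>-\<Delta>\<close> on both
sides: from below by 0, and from above by twice any bound on the degrees.\<close>

lemma adjacency_form_le_degree_form:
  assumes S: "finite S"
  shows "\<bar>Re (\<Sum>x\<in>S. \<Sum>y\<in>S. of_bool ((x, y) \<in> E) * f y * cnj (f x))\<bar>
    \<le> (\<Sum>x\<in>S. deg E x * (cmod (f x))\<^sup>2)"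
proof -
  have "\<bar>Re (\<Sum>x\<in>S. \<Sum>y\<in>S. of_bool ((x, y) \<in> E) * f y * cnj (f x))\<bar>
      \<le> cmod (\<Sum>x\<in>S. \<Sum>y\<in>S. of_bool ((x, y) \<in> E) * f y * cnj (f x))" by (rule abs_Re_le_cmod)
  also have "\<dots> \<le> (\<Sum>x\<in>S. \<Sum>y\<in>S. cmod (of_bool ((x, y) \<in> E) * f y * cnj (f x)))"
    by (rule order_trans[OF norm_sum], intro sum_mono, rule norm_sum)
  also have "\<dots> \<le> (\<Sum>x\<in>S. \<Sum>y\<in>S. of_bool ((x, y) \<in> E) * (cmod (f x))\<^sup>2 / 2 + of_bool ((x, y) \<in> E) * (cmod (f y))\<^sup>2 / 2)"
  proof (intro sum_mono)
    fix x y
    have "cmod (f y) * cmod (f x) \<le> (cmod (f x))\<^sup>2 / 2 + (cmod (f y))\<^sup>2 / 2"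
      using sum_squares_bound[of "cmod (f y)" "cmod (f x)"] by simp
    then show "cmod (of_bool ((x, y) \<in> E) * f y * cnj (f x))
        \<le> of_bool ((x, y) \<in> E) * (cmod (f x))\<^sup>2 / 2 + of_bool ((x, y) \<in> E) * (cmod (f y))\<^sup>2 / 2"
      by (auto simp: norm_mult of_bool_def)
  qed
  also have "\<dots> = (\<Sum>x\<in>S. \<Sum>y\<in>S. of_bool ((x, y) \<in> E) * (cmod (f x))\<^sup>2 / 2)
      + (\<Sum>x\<in>S. \<Sum>y\<in>S. of_bool ((x, y) \<in> E) * (cmod (f y))\<^sup>2 / 2)" by (simp add: sum.distrib)
  also have "(\<Sum>x\<in>S. \<Sum>y\<in>S. of_bool ((x, y) \<in> E) * (cmod (f y))\<^sup>2 / 2)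
      = (\<Sum>x\<in>S. \<Sum>y\<in>S. of_bool ((x, y) \<in> E) * (cmod (f x))\<^sup>2 / 2)"
    by (subst sum.swap) (simp add: sym_edge)
  also have "(\<Sum>x\<in>S. \<Sum>y\<in>S. of_bool ((x, y) \<in> E) * (cmod (f x))\<^sup>2 / 2)
      = (\<Sum>x\<in>S. card (neighbors E x \<inter> S) * (cmod (f x))\<^sup>2 / 2)"
  proof (intro sum.cong refl)
    fix x
    have "(\<Sum>y\<in>S. of_bool ((x, y) \<in> E) * (cmod (f x))\<^sup>2 / 2)
        = (\<Sum>y\<in>neighbors E x \<inter> S. (cmod (f x))\<^sup>2 / 2)"
      using S by (intro sum.mono_neutral_cong_right) (auto simp: neighbors_def)
    then show "(\<Sum>y\<in>S. of_bool ((x, y) \<in> E) * (cmod (f x))\<^sup>2 / 2)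
        = card (neighbors E x \<inter> S) * (cmod (f x))\<^sup>2 / 2" by simp
  qed
  also have "\<dots> + \<dots> = (\<Sum>x\<in>S. card (neighbors E x \<inter> S) * (cmod (f x))\<^sup>2)"
    by (simp add: sum.distrib[symmetric])
  also have "\<dots> \<le> (\<Sum>x\<in>S. deg E x * (cmod (f x))\<^sup>2)"
    by (intro sum_mono mult_right_mono) (auto simp: deg_def finite_neighbors intro!: card_mono)
  finally show ?thesis .
qed

lemma neg_laplacian_form:
  assumes S: "finite S" "S \<subseteq> V" "f \<in> functions_on S"
  shows "Re (inner_G V (neg_laplacian E f) f) = (\<Sum>x\<in>S. deg E x * (cmod (f x))\<^sup>2)
    - Re (\<Sum>x\<in>S. \<Sum>y\<in>S. of_bool ((x, y) \<in> E) * f y * cnj (f x))"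
  unfolding inner_neg_laplacian[OF S S(3)] minus_complex.sel Re_sum[of _ S]
  by (intro arg_cong2[of _ _ _ _ "(-)"] sum.cong refl)
    (simp add: cmod_power2, simp add: power2_eq_square algebra_simps)

lemma neg_laplacian_form_nonneg:
  assumes "f \<in> C0 V"
  shows "0 \<le> Re (inner_G V (neg_laplacian E f) f)"
proof -
  obtain S where S: "finite S" "S \<subseteq> V" "f \<in> functions_on S" using C0_support assms by metis
  show ?thesis using adjacency_form_le_degree_form[OF S(1), of f] neg_laplacian_form[OF S] by linarith
qed

lemma neg_laplacian_form_bounded:
  "\<exists>D\<ge>0. \<forall>f\<in>C0 V. Re (inner_G V (neg_laplacian E f) f) \<le> D * Re (inner_G V f f)"
proof -
  obtain d where d: "\<And>x. x \<in> V \<Longrightarrow> deg E x \<le> d"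
    using bounded by (auto simp: bdd_above_def)
  have "Re (inner_G V (neg_laplacian E f) f) \<le> 2 * real d * Re (inner_G V f f)" if f: "f \<in> C0 V" for f
  proof -
    obtain S where S: "finite S" "S \<subseteq> V" "f \<in> functions_on S" using C0_support f by metis
    have "Re (inner_G V (neg_laplacian E f) f) \<le> 2 * (\<Sum>x\<in>S. deg E x * (cmod (f x))\<^sup>2)"
      using adjacency_form_le_degree_form[OF S(1), of f] neg_laplacian_form[OF S] by linarith
    also have "\<dots> \<le> 2 * (\<Sum>x\<in>S. d * (cmod (f x))\<^sup>2)"
      using d S(2) by (intro mult_left_mono sum_mono mult_right_mono) auto
    finally show ?thesis by (simp add: inner_G_self_sum[OF S] sum_distrib_left algebra_simps)
  qed
  then show ?thesis by (intro exI[of _ "2 * real d"]) auto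
qed

lemma inner_power_split:
  assumes "f \<in> C0 V"
  shows "inner_G V ((neg_laplacian E ^^ (m + n)) f) f
    = inner_G V ((neg_laplacian E ^^ m) f) ((neg_laplacian E ^^ n) f)"
proof -
  have "inner_G V ((neg_laplacian E ^^ n) ((neg_laplacian E ^^ m) f)) f
      = inner_G V ((neg_laplacian E ^^ m) f) ((neg_laplacian E ^^ n) f)"
    using funpow_symmetric[OF neg_laplacian_C0 neg_laplacian_symmetric, of n] power_C0[OF assms, of m] assms
    unfolding symmetric_on_def by blast
  then show ?thesis by (simp only: add.commute[of m n] funpow_add comp_apply)
qed

text \<open>Even moments are squared norms and odd ones are values of the form of \<open>A\<close>: \<open>m\<^sub>2\<^sub>i(f) = \<parallel>A\<^sup>i f\<parallel>\<^sup>2\<close> and \<open>m\<^sub>2\<^sub>i\<^sub>+\<^sub>1(f) = \<langle>A g, g\<rangle>\<close> for \<open>g = A\<^sup>i f\<close>. Inequalities between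
consecutive moments thus reduce to inequalities for \<open>A\<close> itself.\<close>

lemma poly_form_even: "f \<in> C0 V \<Longrightarrow> poly_form V E (i + i) f
    = Re (inner_G V ((neg_laplacian E ^^ i) f) ((neg_laplacian E ^^ i) f))"
  by (simp only: poly_form_def inner_power_split)

lemma poly_form_odd: "f \<in> C0 V \<Longrightarrow> poly_form V E (Suc (i + i)) f
    = Re (inner_G V (neg_laplacian E ((neg_laplacian E ^^ i) f)) ((neg_laplacian E ^^ i) f))"
  using inner_power_split[of f "Suc i" i] by (simp only: poly_form_def add_Suc funpow.simps comp_apply)

lemma poly_form_nonneg: "f \<in> C0 V \<Longrightarrow> 0 \<le> poly_form V E l f"
proof (cases "even l")
  case True
  assume f: "f \<in> C0 V"
  obtain i where "l = i + i" using True by (metis evenE mult_2)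
  then show ?thesis by (simp only: poly_form_even[OF f] inner_G_self_nonneg[OF power_C0[OF f]])
next
  case False
  assume f: "f \<in> C0 V"
  obtain i where "l = Suc (i + i)" using False by (metis oddE mult_2 Suc_eq_plus1)
  then show ?thesis by (simp only: poly_form_odd[OF f] neg_laplacian_form_nonneg[OF power_C0[OF f]])
qed

section \<open>Variational characterization of the eigenvalues\<close>

definition admissible :: "nat \<Rightarrow> ('a \<Rightarrow> complex) set set" where
  "admissible k = {M. cfun.subspace M \<and> M \<subseteq> C0 V \<and> cfun.dim M = k}"

definition max_form :: "nat \<Rightarrow> ('a \<Rightarrow> complex) set \<Rightarrow> real" where
  "max_form l M = (GREATEST r. r \<in> poly_form V E l ` {f \<in> M. norm2 V f = 1})"

lemma lambda_G_eq: "lambda_G V E l k = (INF M \<in> admissible k. max_form l M)"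
  by (simp only: lambda_G_def admissible_def max_form_def)

lemma max_form_attained:
  assumes M: "M \<in> admissible k" and k: "k \<ge> 1"
  shows "\<exists>f\<in>M. norm2 V f = 1 \<and> poly_form V E l f = max_form l M"
    and "\<And>g. g \<in> M \<Longrightarrow> norm2 V g = 1 \<Longrightarrow> poly_form V E l g \<le> max_form l M"
proof -
  have M': "cfun.subspace M" "M \<subseteq> C0 V" "cfun.dim M = k" using M by (auto simp: admissible_def)
  obtain B where B: "finite B" "card B = k" "B \<subseteq> M" "cfun.span B = M"
    using subspace_finite_basis[OF M'(1,3) k] by metis
  obtain S where S: "orthonormal V S" "cfun.span S = M"
    using orthonormal_basis_exists[OF M'(1) _ B(1)] B M'(2) by blast
  have "S \<noteq> {}"
  proof
    assume "S = {}"
    then show False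
      using cfun.dim_span_eq_card_independent[OF orthonormal_independent[OF S(1)]] S(2) M'(3) k by simp
  qed
  moreover have "(neg_laplacian E ^^ l) ` cfun.span S \<subseteq> C0 V" using S(2) M'(2) power_C0 by blast
  ultimately obtain f where f: "f \<in> M" "norm2 V f = 1"
    "\<And>g. g \<in> M \<Longrightarrow> norm2 V g = 1 \<Longrightarrow> poly_form V E l g \<le> poly_form V E l f"
    using quadratic_form_attains_max[OF S(1) _ funpow_linear[OF neg_laplacian_linear]] S(2)
    unfolding poly_form_def by metis
  have "max_form l M = poly_form V E l f"
    unfolding max_form_def by (rule Greatest_equality) (use f in auto)
  then show "\<exists>f\<in>M. norm2 V f = 1 \<and> poly_form V E l f = max_form l M"
    and "\<And>g. g \<in> M \<Longrightarrow> norm2 V g = 1 \<Longrightarrow> poly_form V E l g \<le> max_form l M"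
    using f by auto
qed

lemma max_form_nonneg:
  assumes "M \<in> admissible k" "k \<ge> 1" shows "0 \<le> max_form l M"
proof -
  obtain f where f: "f \<in> M" "poly_form V E l f = max_form l M" using max_form_attained(1)[OF assms] by blast
  have "f \<in> C0 V" using f(1) assms(1) by (auto simp: admissible_def)
  from poly_form_nonneg[OF this, of l] f(2) show ?thesis by simp
qed

lemma lambda_G_le:
  assumes "M \<in> admissible k" "k \<ge> 1" shows "lambda_G V E l k \<le> max_form l M"
  unfolding lambda_G_eq
  by (rule cINF_lower[OF _ assms(1)]) (use max_form_nonneg assms(2) in \<open>auto simp: bdd_below_def\<close>)

lemma admissible_nonempty:
  assumes "infinite V" shows "admissible k \<noteq> {}"
proof -
  obtain F where F: "F \<subseteq> V" "finite F" "card F = k"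
    using infinite_arbitrarily_large[OF assms] by blast
  obtain D where D: "orthonormal V D" "cfun.span D = functions_on F" "card D = card F"
    using functions_on_orthonormal_basis[OF F(2,1)] .
  have "cfun.dim (functions_on F) = k"
    using cfun.dim_span_eq_card_independent[OF orthonormal_independent[OF D(1)]] D F by simp
  then have "functions_on F \<in> admissible k"
    using functions_on_subspace functions_on_subset_C0[OF F(2,1)] by (auto simp: admissible_def)
  then show ?thesis by blast
qed

lemma lambda_G_approx:
  assumes "infinite V" "lambda_G V E l k < c"
  obtains M where "M \<in> admissible k" "max_form l M < c"
  using cInf_lessD[of "max_form l ` admissible k" c] admissible_nonempty[OF assms(1), of k] assms(2)
  by (auto simp: lambda_G_eq)

lemma lambda_G_nonneg:
  assumes "infinite V" "k \<ge> 1" shows "0 \<le> lambda_G V E l k"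
  unfolding lambda_G_eq
  by (rule cINF_greatest[OF admissible_nonempty[OF assms(1)]]) (use max_form_nonneg assms(2) in auto)

text \<open>The operator \<open>T\<close> below is self-adjoint on the functions on \<open>W\<close> because its form there is that of
\<open>(-\<Delta>)\<^sup>l\<close>: the values that the restriction to \<open>W\<close> discards are multiplied by zero in the inner product.\<close>

lemma lambda_W_minmax:
  assumes W: "finite W" "W \<subseteq> V" and k: "1 \<le> k" "k \<le> card W"
  shows "\<exists>M\<in>admissible k. max_form l M \<le> lambda_W E l k W"
    and "\<And>M. M \<in> admissible k \<Longrightarrow> M \<subseteq> functions_on W \<Longrightarrow> lambda_W E l k W \<le> max_form l M"
proof -
  define T where "T f = cscale ((- 1) ^ l) (dirichlet_op E l W f)" for f
  have T: "T f = restrict_zero W ((neg_laplacian E ^^ l) (restrict_zero W f))" for f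
    by (simp add: T_def dirichlet_op_def neg_laplacian_power restrict_zero_def fun_eq_iff)
  have res: "restrict_zero W f = f" if "f \<in> functions_on W" for f :: "'a \<Rightarrow> complex"
    using that by (auto simp: restrict_zero_def functions_on_def)
  have res_lin: "clinear (restrict_zero W)"
    by (intro clinearI) (auto simp: restrict_zero_def fun_eq_iff)
  note A_lin = funpow_linear[OF neg_laplacian_linear, of l E]
  have linT: "clinear T"
    by (intro clinearI) (simp_all only: T cpair.linear_add[OF res_lin] cpair.linear_scale[OF res_lin]
        cpair.linear_add[OF A_lin] cpair.linear_scale[OF A_lin])
  have inv: "T f \<in> functions_on W" for f by (simp add: T restrict_zero_def functions_on_def)
  have form: "inner_G V (T f) g = inner_G V ((neg_laplacian E ^^ l) f) g"
    if fg: "f \<in> functions_on W" "g \<in> functions_on W" for f g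
  proof -
    have "inner_G V g (T f) = inner_G V g ((neg_laplacian E ^^ l) f)"
      unfolding inner_G_eq_sum[OF W fg(2)] T res[OF fg(1)]
      by (intro sum.cong) (auto simp: restrict_zero_def)
    then show ?thesis using inner_G_commute by metis
  qed
  have WC: "functions_on W \<subseteq> C0 V" by (rule functions_on_subset_C0[OF W])
  have sym: "symmetric_on V (functions_on W) T"
    unfolding symmetric_on_def
  proof (intro ballI)
    fix f g assume fg: "f \<in> functions_on W" "g \<in> functions_on W"
    have "inner_G V (T f) g = inner_G V f ((neg_laplacian E ^^ l) g)"
      using funpow_symmetric[OF neg_laplacian_C0 neg_laplacian_symmetric, of l] fg WC
      by (auto simp: form symmetric_on_def)
    also have "\<dots> = inner_G V f (T g)"
      using form[OF fg(2,1)] inner_G_commute by metis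
    finally show "inner_G V (T f) g = inner_G V f (T g)" .
  qed
  obtain D where D: "orthonormal V D" "cfun.span D = functions_on W" "card D = card W"
    using functions_on_orthonormal_basis[OF W] .
  have D': "functions_on W \<subseteq> cfun.span D" "finite D" "D \<subseteq> C0 V" "T ` functions_on W \<subseteq> functions_on W"
    using D inv by (auto simp: orthonormal_def)
  obtain S \<mu> where S: "orthonormal V S" "cfun.span S = functions_on W"
    "\<And>s. s \<in> S \<Longrightarrow> T s = cscale (complex_of_real (\<mu> s)) s"
    using spectral_theorem[OF functions_on_subspace D'(1-3) linT D'(4) sym] by blast
  have card: "card S = card W"
    using cfun.dim_span_eq_card_independent[OF orthonormal_independent[OF D(1)]]
      cfun.dim_span_eq_card_independent[OF orthonormal_independent[OF S(1)]] S(2) D(2,3) by simp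
  have "dirichlet_eigenvalues E l W = image_mset \<mu> (mset_set S)"
    using eigenvalue_multiset_of_eigenbasis[OF S(1) linT S(3)]
    by (simp only: dirichlet_eigenvalues_def dirichlet_eigenspace_def S(2) T_def)
  then have lam: "lambda_W E l k W = sorted_list_of_multiset (image_mset \<mu> (mset_set S)) ! (k - 1)"
    by (simp only: lambda_W_def)
  have pf: "Re (inner_G V (T f) f) = poly_form V E l f" if "f \<in> functions_on W" for f
    by (simp only: form[OF that that] poly_form_def)
  have k': "k \<le> card S" using k card by simp
  note CF = Courant_Fischer[OF S(1) linT S(3) k(1) k', folded lam, unfolded S(2)]
  obtain M where M: "cfun.subspace M" "M \<subseteq> functions_on W" "cfun.dim M = k"
    "\<And>f. f \<in> M \<Longrightarrow> norm2 V f = 1 \<Longrightarrow> Re (inner_G V (T f) f) \<le> lambda_W E l k W"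
    using CF(1) by blast
  have adm: "M \<in> admissible k" using M WC by (auto simp: admissible_def)
  obtain f where f: "f \<in> M" "norm2 V f = 1" "poly_form V E l f = max_form l M"
    using max_form_attained(1)[OF adm k(1)] by blast
  have "max_form l M \<le> lambda_W E l k W" using M(4)[OF f(1,2)] pf[of f] f M(2) by auto
  then show "\<exists>M\<in>admissible k. max_form l M \<le> lambda_W E l k W" using adm by blast
  fix M assume M: "M \<in> admissible k" "M \<subseteq> functions_on W"
  then have "cfun.subspace M" "cfun.dim M = k" by (auto simp: admissible_def)
  then obtain f where f: "f \<in> M" "norm2 V f = 1" "lambda_W E l k W \<le> Re (inner_G V (T f) f)"
    using CF(2) M(2) by blast
  have "lambda_W E l k W \<le> poly_form V E l f" using f(1,3) M(2) pf[of f] by auto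
  also have "\<dots> \<le> max_form l M" by (rule max_form_attained(2)[OF M(1) k(1) f(1,2)])
  finally show "lambda_W E l k W \<le> max_form l M" .
qed

section \<open>Convergence along an exhaustion\<close>

lemma exhaustion_eventually_contains:
  assumes W: "exhaustion V W" and F: "finite F" "F \<subseteq> V"
  shows "\<forall>\<^sub>F i in sequentially. F \<subseteq> W i"
proof -
  have mono: "W i \<subseteq> W j" if "1 \<le> i" "i \<le> j" for i j
    using that(2)
  proof (induction rule: dec_induct)
    case (step n)
    have "W n \<subseteq> W (Suc n)" using W step(1) that(1) by (simp add: exhaustion_def)
    then show ?case using step by blast
  qed simp
  have "\<forall>\<^sub>F i in sequentially. x \<in> W i" if x: "x \<in> F" for x
  proof -
    obtain j where j: "j \<ge> 1" "x \<in> W j" using x F(2) W by (auto simp: exhaustion_def)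
    then show ?thesis using mono by (auto simp: eventually_sequentially)
  qed
  then have "\<forall>\<^sub>F i in sequentially. \<forall>x\<in>F. x \<in> W i"
    using F(1) by (simp add: eventually_ball_finite_distrib)
  then show ?thesis by (rule eventually_mono) auto
qed

text \<open>The lower bound holds for every \<open>W\<^sub>i\<close> with at least \<open>k\<close> vertices, because its optimal space competes in
the infimum over \<open>G\<close>; the upper bound holds once \<open>W\<^sub>i\<close> contains the common support of an almost optimal
space for \<open>G\<close>.\<close>

theorem lambda_W_tendsto_lambda_G:
  assumes inf: "infinite V" and W: "exhaustion V W" and k: "k \<ge> 1"
  shows "(\<lambda>i. lambda_W E l k (W i)) \<longlonglongrightarrow> lambda_G V E l k"
proof -
  obtain F where F: "F \<subseteq> V" "finite F" "card F = k"
    using infinite_arbitrarily_large[OF inf] by blast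
  have big: "\<forall>\<^sub>F i in sequentially. finite (W i) \<and> W i \<subseteq> V \<and> k \<le> card (W i)"
    using exhaustion_eventually_contains[OF W F(2,1)] eventually_ge_at_top[of 1]
  proof eventually_elim
    case (elim i)
    then have "finite (W i)" "W i \<subseteq> V" using W by (auto simp: exhaustion_def)
    then show ?case using card_mono[of "W i" F] elim F(3) by auto
  qed
  show ?thesis
  proof (rule order_tendstoI)
    fix c assume c: "c < lambda_G V E l k"
    show "\<forall>\<^sub>F i in sequentially. c < lambda_W E l k (W i)"
      using big
    proof eventually_elim
      case (elim i)
      then obtain M where "M \<in> admissible k" "max_form l M \<le> lambda_W E l k (W i)"
        using lambda_W_minmax(1)[of "W i" k] k by blast
      then show ?case using lambda_G_le[of M k l] k c by linarith
    qed
  next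
    fix c assume "lambda_G V E l k < c"
    then obtain M where M: "M \<in> admissible k" "max_form l M < c" using lambda_G_approx[OF inf] by blast
    then obtain F where F: "finite F" "F \<subseteq> V" "M \<subseteq> functions_on F"
      using finite_dim_common_support[of M V k] k by (auto simp: admissible_def)
    show "\<forall>\<^sub>F i in sequentially. lambda_W E l k (W i) < c"
      using big exhaustion_eventually_contains[OF W F(1,2)]
    proof eventually_elim
      case (elim i)
      then have "M \<subseteq> functions_on (W i)" using F(3) by (auto simp: functions_on_def)
      then have "lambda_W E l k (W i) \<le> max_form l M"
        using lambda_W_minmax(2)[of "W i" k M] elim k M(1) by blast
      then show ?case using M(2) by linarith
    qed
  qed
qed

section \<open>Powers of the bottom of the spectrum\<close>

text \<open>For \<open>k = 1\<close> the form is constant on the unit circle of the line spanned by \<open>f\<close>, so the minimax value is the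
infimum of the form over unit vectors.\<close>

lemma lambda_G_1_le:
  assumes f: "f \<in> C0 V" "norm2 V f = 1" shows "lambda_G V E l 1 \<le> poly_form V E l f"
proof -
  have "f \<noteq> 0" using f(2) by (auto simp: norm2_eq_1_iff)
  then have "cfun.dim (cfun.span {f}) = 1"
    using cfun.dim_span_eq_card_independent[of "{f}"] by simp
  then have adm: "cfun.span {f} \<in> admissible 1"
    using f(1) cfun.span_minimal[of "{f}" "C0 V", OF _ C0_subspace] by (simp add: admissible_def)
  obtain g where g: "g \<in> cfun.span {f}" "norm2 V g = 1" "poly_form V E l g = max_form l (cfun.span {f})"
    using max_form_attained(1)[OF adm] by blast
  obtain c where c: "g = cscale c f" using g(1) by (auto simp: cfun.span_singleton)
  have form: "inner_G V ((neg_laplacian E ^^ n) g) g = c * cnj c * inner_G V ((neg_laplacian E ^^ n) f) f" for n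
    unfolding c cpair.linear_scale[OF funpow_linear[OF neg_laplacian_linear]]
    using f(1) power_C0[OF f(1)] cfun.subspace_scale[OF C0_subspace]
    by (simp only: inner_G_scale_left inner_G_scale_right mult_ac)
  have "Re (c * cnj c * inner_G V f f) = 1"
    using form[of 0] g(2) by (simp add: norm2_eq_1_iff)
  then have "c * cnj c = 1"
    using f(2) inner_G_self_real[of V f] by (simp add: norm2_eq_1_iff complex_eq_iff)
  then have "poly_form V E l g = poly_form V E l f"
    unfolding poly_form_def form by simp
  then show ?thesis using g(3) lambda_G_le[OF adm order_refl, of l] by linarith
qed

lemma lambda_G_1_approx:
  assumes "infinite V" "lambda_G V E l 1 < c"
  obtains f where "f \<in> C0 V" "norm2 V f = 1" "poly_form V E l f < c"
proof -
  obtain M where M: "M \<in> admissible 1" "max_form l M < c" using lambda_G_approx[OF assms] .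
  obtain f where "f \<in> M" "norm2 V f = 1" "poly_form V E l f = max_form l M"
    using max_form_attained(1)[OF M(1)] by blast
  then show ?thesis using that M by (auto simp: admissible_def)
qed


lemma power_norm_bound:
  "\<exists>D\<ge>0. (\<forall>f\<in>C0 V. Re (inner_G V (neg_laplacian E f) f) \<le> D * Re (inner_G V f f)) \<and>
    (\<forall>f\<in>C0 V. \<forall>j. norm2 V f = 1 \<longrightarrow>
      Re (inner_G V ((neg_laplacian E ^^ j) f) ((neg_laplacian E ^^ j) f)) \<le> D ^ j)"
proof -
  obtain d where d: "0 \<le> d"
    "\<And>f. f \<in> C0 V \<Longrightarrow> Re (inner_G V (neg_laplacian E f) f) \<le> d * Re (inner_G V f f)"
    using neg_laplacian_form_bounded by blast
  \<comment> \<open>One constant serving as a bound for \<open>A\<close> and for \<open>A\<^sup>2\<close>.\<close>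
  define D where "D = max d (d * d)"
  have one: "Re (inner_G V (neg_laplacian E f) (neg_laplacian E f)) \<le> D * Re (inner_G V f f)"
    if f: "f \<in> C0 V" for f
  proof -
    have "Re (inner_G V (neg_laplacian E f) (neg_laplacian E f)) \<le> d * Re (inner_G V (neg_laplacian E f) f)"
      using neg_laplacian_C0
      by (intro norm_bound_of_form_bound[OF C0_subspace _ neg_laplacian_linear _ neg_laplacian_symmetric
            neg_laplacian_form_nonneg d(2,1) f]) auto
    also have "\<dots> \<le> d * (d * Re (inner_G V f f))" using d f by (intro mult_left_mono) auto
    also have "\<dots> = (d * d) * Re (inner_G V f f)" by simp
    also have "\<dots> \<le> D * Re (inner_G V f f)"
      using inner_G_self_nonneg[OF f] by (intro mult_right_mono) (auto simp: D_def)
    finally show ?thesis .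
  qed
  have D0: "0 \<le> D" using d(1) by (simp add: D_def)
  have "Re (inner_G V ((neg_laplacian E ^^ j) f) ((neg_laplacian E ^^ j) f)) \<le> D ^ j"
    if f: "f \<in> C0 V" "norm2 V f = 1" for f j
  proof (induction j)
    case (Suc j)
    have "Re (inner_G V ((neg_laplacian E ^^ Suc j) f) ((neg_laplacian E ^^ Suc j) f))
        \<le> D * Re (inner_G V ((neg_laplacian E ^^ j) f) ((neg_laplacian E ^^ j) f))"
      unfolding funpow.simps comp_apply by (rule one[OF power_C0[OF f(1)]])
    also have "\<dots> \<le> D * D ^ j" by (rule mult_left_mono[OF Suc D0])
    finally show ?case by (simp only: power_Suc)
  qed (use f(2) in \<open>simp add: norm2_eq_1_iff\<close>)
  moreover have "Re (inner_G V (neg_laplacian E f) f) \<le> D * Re (inner_G V f f)" if f: "f \<in> C0 V" for f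
    using d(2)[OF f] mult_right_mono[OF max.cobounded1[of d "d * d"] inner_G_self_nonneg[OF f]]
    by (simp add: D_def)
  ultimately show ?thesis using D0 by (intro exI[of _ D] conjI ballI allI impI)
qed

lemma poly_form_0: "norm2 V f = 1 \<Longrightarrow> poly_form V E 0 f = 1"
  by (simp add: poly_form_def norm2_eq_1_iff)

text \<open>For even \<open>l\<close> this is \<open>A \<ge> L\<close>, tested on \<open>g = A\<^sup>i f\<close>. For odd \<open>l\<close> it reads \<open>\<parallel>A g\<parallel>\<^sup>2 \<ge> L \<langle>A g, g\<rangle>\<close>, which follows from
\<open>\<langle>A g, g\<rangle>\<^sup>2 \<le> \<parallel>A g\<parallel>\<^sup>2 \<parallel>g\<parallel>\<^sup>2\<close> and \<open>L \<parallel>g\<parallel>\<^sup>2 \<le> \<langle>A g, g\<rangle>\<close>.\<close>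

lemma poly_form_Suc_ge:
  assumes L: "0 \<le> L" "\<And>f. f \<in> C0 V \<Longrightarrow> L * Re (inner_G V f f) \<le> Re (inner_G V (neg_laplacian E f) f)"
    and f: "f \<in> C0 V"
  shows "L * poly_form V E l f \<le> poly_form V E (Suc l) f"
proof (cases "even l")
  case True
  then obtain i where l: "l = i + i" by (metis evenE mult_2)
  show ?thesis
    unfolding l poly_form_even[OF f] poly_form_odd[OF f] by (rule L(2)[OF power_C0[OF f]])
next
  case False
  then obtain i where l: "l = Suc (i + i)" by (metis oddE mult_2 Suc_eq_plus1)
  define g where "g = (neg_laplacian E ^^ i) f"
  define b where "b = Re (inner_G V (neg_laplacian E g) g)"
  define n where "n = Re (inner_G V g g)"
  define m where "m = Re (inner_G V (neg_laplacian E g) (neg_laplacian E g))"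
  have g: "g \<in> C0 V" unfolding g_def by (rule power_C0[OF f])
  have n: "0 \<le> n" unfolding n_def by (rule inner_G_self_nonneg[OF g])
  have m: "0 \<le> m" unfolding m_def by (rule inner_G_self_nonneg[OF neg_laplacian_C0[OF g]])
  have Lb: "L * n \<le> b" unfolding n_def b_def by (rule L(2)[OF g])
  then have b: "0 \<le> b" using n L(1) by (meson mult_nonneg_nonneg order_trans)
  have "b\<^sup>2 \<le> (cmod (inner_G V (neg_laplacian E g) g))\<^sup>2"
    using abs_Re_le_cmod[of "inner_G V (neg_laplacian E g) g"] b by (intro power_mono) (auto simp: b_def)
  also have "\<dots> \<le> m * n"
    unfolding m_def n_def by (rule Cauchy_Schwarz_inner_G[OF neg_laplacian_C0[OF g] g])
  finally have bm: "b\<^sup>2 \<le> m * n" .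
  have "L * b \<le> m"
  proof (cases "b = 0")
    case False
    have "(L * b) * b \<le> L * (m * n)" using bm L(1) by (simp add: power2_eq_square mult_left_mono mult.assoc)
    also have "\<dots> = m * (L * n)" by simp
    also have "\<dots> \<le> m * b" using Lb m by (rule mult_left_mono)
    finally show ?thesis using False b by simp
  qed (use m in simp)
  moreover have "poly_form V E (Suc l) f = m"
    using poly_form_even[OF f, of "Suc i"] by (simp only: l m_def g_def add_Suc add_Suc_right funpow.simps comp_apply)
  moreover have "poly_form V E l f = b"
    using poly_form_odd[OF f, of i] by (simp only: l b_def g_def)
  ultimately show ?thesis by simp
qed

text \<open>The inequality \<open>\<le>\<close> iterates \<open>poly_form_Suc_ge\<close>; for \<open>\<ge>\<close>, a minimizing sequence for \<open>l = 1\<close> consists of approximate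
eigenvectors of \<open>A\<close> with eigenvalue \<open>L\<close>, so it is minimizing for every power of \<open>A\<close> as well.\<close>

theorem lambda_G_1_power:
  assumes inf: "infinite V"
  shows "lambda_G V E 1 1 ^ l = lambda_G V E l 1"
proof (rule antisym)
  define L where "L = lambda_G V E 1 1"
  have L0: "0 \<le> L" unfolding L_def by (rule lambda_G_nonneg[OF inf]) simp
  have low: "L * Re (inner_G V f f) \<le> Re (inner_G V (neg_laplacian E f) f)" if f: "f \<in> C0 V" for f
  proof (rule quadratic_form_lower_bound[OF C0_subspace order_refl neg_laplacian_linear _ _ f])
    fix u assume "u \<in> C0 V" "norm2 V u = 1"
    then have "L \<le> poly_form V E 1 u" unfolding L_def by (rule lambda_G_1_le)
    then show "L \<le> Re (inner_G V (neg_laplacian E u) u)" by (simp add: poly_form_def)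
  qed (use neg_laplacian_C0 in auto)
  have pow: "L ^ j \<le> poly_form V E j f" if f: "f \<in> C0 V" "norm2 V f = 1" for f j
  proof (induction j)
    case (Suc j)
    have "L ^ Suc j \<le> L * poly_form V E j f" using Suc L0 by (simp add: mult_left_mono)
    also have "\<dots> \<le> poly_form V E (Suc j) f" by (rule poly_form_Suc_ge[OF L0 low f(1)])
    finally show ?case .
  qed (simp add: poly_form_0[OF f(2)])
  show "lambda_G V E 1 1 ^ l \<le> lambda_G V E l 1"
  proof (rule ccontr)
    assume "\<not> ?thesis"
    then have "lambda_G V E l 1 < L ^ l" by (simp add: L_def)
    then obtain f where "f \<in> C0 V" "norm2 V f = 1" "poly_form V E l f < L ^ l"
      using lambda_G_1_approx[OF inf] by blast
    then show False using pow[of f l] by simp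
  qed
  obtain D where D: "0 \<le> D"
    "\<And>f j. f \<in> C0 V \<Longrightarrow> norm2 V f = 1 \<Longrightarrow>
      Re (inner_G V ((neg_laplacian E ^^ j) f) ((neg_laplacian E ^^ j) f)) \<le> D ^ j"
    "\<And>f. f \<in> C0 V \<Longrightarrow> Re (inner_G V (neg_laplacian E f) f) \<le> D * Re (inner_G V f f)"
    using power_norm_bound by (elim exE conjE) (rule that, auto)
  define B where "B = (\<lambda>g. cscale (of_real 1) (neg_laplacian E g) + cscale (of_real (- L)) g)"
  have AC: "neg_laplacian E ` C0 V \<subseteq> C0 V" using neg_laplacian_C0 by auto
  note B = affine_operator[OF C0_subspace order_refl neg_laplacian_linear AC neg_laplacian_symmetric,
      where a = 1 and b = "- L", folded B_def]
  have B_form: "Re (inner_G V (B g) g) = Re (inner_G V (neg_laplacian E g) g) - L * Re (inner_G V g g)"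
    if "g \<in> C0 V" for g
    unfolding B_def by (subst B(4)[OF that]) simp
  have B_norm: "Re (inner_G V (B f) (B f)) \<le> D * (poly_form V E 1 f - L)"
    if f: "f \<in> C0 V" "norm2 V f = 1" for f
  proof -
    have "Re (inner_G V (B f) (B f)) \<le> D * Re (inner_G V (B f) f)"
    proof (rule norm_bound_of_form_bound[OF C0_subspace order_refl B(1-3) _ _ D(1) f(1)])
      fix g assume g: "g \<in> C0 V"
      show "0 \<le> Re (inner_G V (B g) g)" using low[OF g] B_form[OF g] by simp
      have "0 \<le> L * Re (inner_G V g g)" using L0 inner_G_self_nonneg[OF g] by simp
      then show "Re (inner_G V (B g) g) \<le> D * Re (inner_G V g g)"
        using D(3)[OF g] B_form[OF g] by linarith
    qed
    also have "Re (inner_G V (B f) f) = poly_form V E 1 f - L"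
      using B_form[OF f(1)] f(2) by (simp add: poly_form_def norm2_eq_1_iff)
    finally show ?thesis .
  qed
  have step: "\<bar>poly_form V E (Suc j) f - L * poly_form V E j f\<bar> \<le> sqrt (D * (poly_form V E 1 f - L) * D ^ j)"
    if f: "f \<in> C0 V" "norm2 V f = 1" for f j
  proof -
    define h where "h = (neg_laplacian E ^^ j) f"
    have h: "h \<in> C0 V" unfolding h_def by (rule power_C0[OF f(1)])
    have Bf: "B f \<in> C0 V" using B(2) f(1) by auto
    have "inner_G V (B f) h = inner_G V (neg_laplacian E f) h - of_real L * inner_G V f h"
      unfolding B_def by (subst B(4)[OF f(1)]) simp
    moreover have "poly_form V E (Suc j) f = Re (inner_G V (neg_laplacian E f) h)"
      using inner_power_split[OF f(1), of 1 j] by (simp add: poly_form_def h_def)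
    moreover have "poly_form V E j f = Re (inner_G V f h)"
      using inner_power_split[OF f(1), of 0 j] by (simp add: poly_form_def h_def)
    ultimately have "poly_form V E (Suc j) f - L * poly_form V E j f = Re (inner_G V (B f) h)" by simp
    also have "\<bar>\<dots>\<bar> \<le> cmod (inner_G V (B f) h)" by (rule abs_Re_le_cmod)
    also have "\<dots> \<le> sqrt (Re (inner_G V (B f) (B f)) * Re (inner_G V h h))"
      by (rule real_le_rsqrt[OF Cauchy_Schwarz_inner_G[OF Bf h]])
    also have "\<dots> \<le> sqrt (D * (poly_form V E 1 f - L) * D ^ j)"
      using B_norm[OF f] D(2)[OF f, of j] inner_G_self_nonneg[OF h] inner_G_self_nonneg[OF Bf]
      by (intro real_sqrt_le_mono mult_mono) (auto simp: h_def)
    finally show ?thesis .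
  qed
  have "\<exists>f. f \<in> C0 V \<and> norm2 V f = 1 \<and> poly_form V E 1 f < L + 1 / real (Suc n)" for n
    using lambda_G_1_approx[OF inf, where l = 1 and c = "L + 1 / real (Suc n)"] L_def by auto
  then obtain F where F: "\<And>n. F n \<in> C0 V" "\<And>n. norm2 V (F n) = 1"
    "\<And>n. poly_form V E 1 (F n) < L + 1 / real (Suc n)" by metis
  have lim1: "(\<lambda>n. poly_form V E 1 (F n)) \<longlonglongrightarrow> L"
  proof (rule tendsto_sandwich[OF _ _ tendsto_const])
    show "(\<lambda>n. L + 1 / real (Suc n)) \<longlonglongrightarrow> L"
      using tendsto_add[OF tendsto_const LIMSEQ_inverse_real_of_nat, of L] by (simp add: inverse_eq_divide)
    show "\<forall>\<^sub>F n in sequentially. L \<le> poly_form V E 1 (F n)" using pow[OF F(1,2), of 1] by simp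
    show "\<forall>\<^sub>F n in sequentially. poly_form V E 1 (F n) \<le> L + 1 / real (Suc n)"
      using F(3) by (intro always_eventually allI less_imp_le)
  qed
  have lim: "(\<lambda>n. poly_form V E j (F n)) \<longlonglongrightarrow> L ^ j" for j
  proof (induction j)
    case (Suc j)
    have "(\<lambda>n. sqrt (D * (poly_form V E 1 (F n) - L) * D ^ j)) \<longlonglongrightarrow> sqrt (D * (L - L) * D ^ j)"
      by (intro tendsto_intros lim1)
    then have null: "(\<lambda>n. sqrt (D * (poly_form V E 1 (F n) - L) * D ^ j)) \<longlonglongrightarrow> 0" by simp
    have "(\<lambda>n. poly_form V E (Suc j) (F n) - L * poly_form V E j (F n)) \<longlonglongrightarrow> 0"
    proof (rule Lim_null_comparison[OF always_eventually null], rule allI)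
      fix n
      show "norm (poly_form V E (Suc j) (F n) - L * poly_form V E j (F n))
          \<le> sqrt (D * (poly_form V E 1 (F n) - L) * D ^ j)"
        unfolding real_norm_def by (rule step[OF F(1,2)])
    qed
    from tendsto_add[OF this tendsto_mult[OF tendsto_const Suc, of L]] show ?case by simp
  qed (simp add: poly_form_0 F(2))
  show "lambda_G V E l 1 \<le> lambda_G V E 1 1 ^ l"
    unfolding L_def[symmetric]
    by (rule LIMSEQ_le_const[OF lim]) (intro exI allI impI lambda_G_1_le F)
qed

end

theorem theorem1p5:
  fixes V :: "'a set" and E :: "'a rel" and W :: "nat \<Rightarrow> 'a set" and k l :: nat
  assumes "simple_graph V E"
    and "infinite V"
    and "locally_finite V E"
    and "connected_graph V E"
    and "bdd_above (deg E ` V)"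
    and "exhaustion V W"
    and "k \<ge> 1"
    and "l \<ge> 1"
  shows "((\<lambda>i. lambda_W E l k (W i)) \<longlonglongrightarrow> lambda_G V E l k) \<and>
         (lambda_G V E 1 1) ^ l = lambda_G V E l 1 \<and>
         ((\<lambda>i. lambda_W E l 1 (W i)) \<longlonglongrightarrow> lambda_G V E l 1)"
proof -
  interpret bounded_degree_graph V E
    using assms by unfold_locales
  show ?thesis
    using lambda_W_tendsto_lambda_G[OF assms(2,6)] assms(7) lambda_G_1_power[OF assms(2)] by simp
qed

end
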